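(* Assume $\mathfrak g$ is finite dimensional. Let $\beta$ be a nonisotropic positive real root, $\alpha$ a simple nonisotropic root and $\gamma=s_\alpha\beta=\beta+q\alpha$ with $q>0$. Then the Šapovalov algebras $\check S_\gamma$ and $\check S_\beta$ are finitely generated $\mathtt k$-algebras.
   Context: $\mathtt k$ is an algebraically closed field of characteristic $0$. $\mathfrak g$ is a Kac–Moody (contragredient) Lie superalgebra with symmetrizable Cartan matrix, Cartan subalgebra $\mathfrak h$ and fixed base $\Pi$, such that: the adjoint action of every nonisotropic root vector is locally nilpotent; and $U(\mathfrak g)$ has a $\mathbb Z$-form stable under the divided-power adjoint action of root vectors (positive and negative) of simple nonisotropic roots. $\mathfrak g=\mathfrak n^-\oplus\mathfrak h\oplus\mathfrak n^+$ is the triangular decomposition, $s_\alpha$ is the reflection in $\alpha$, and a root is real if it is in the orbit of $\Pi$ under the group generated by reflections in nonisotropic simple roots. Let $e=e_{-\alpha}$ be a root vector of weight $-\alpha$, and $S(\mathfrak n^-)_e$ the localization of the (super)symmetric algebra $S(\mathfrak n^-)$ at powers of $e$; it is graded by weights in $\mathfrak h^*$. For $\tau\in\{\beta,\gamma\}$ the $\tau$-Šapovalov algebra is the graded algebra $$\check S_\tau=\bigoplus_{m\ge0}\check S_\tau(m),\qquad\check S_\tau(m)=(S(\mathfrak n^-)_e)^{-m\tau}$$ (the weight space of weight $-m\tau$). *)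

theory Defs
  imports
    "HOL-Analysis.Analysis"
    "HOL-Library.Poly_Mapping"
    "HOL-Library.Z2"
    "HOL-Algebra.Generated_Rings"
    "HOL-Computational_Algebra.Polynomial"
begin

section \<open>Lie superalgebras with contragredient data\<close>

text \<open>
  The Lie superalgebra and its Cartan subalgebra are the types 'g and 'h (with explicit scalar
  multiplications), and 'i indexes the simple roots. Elements of the dual of the Cartan subalgebra
  are functions from 'h to 'k. Parities are elements of the two-element field.
\<close>

record ('k, 'g, 'h, 'i) superdata =
  scl :: "'k \<Rightarrow> 'g \<Rightarrow> 'g"
  grade :: "bit \<Rightarrow> 'g set"
  brk :: "'g \<Rightarrow> 'g \<Rightarrow> 'g"
  hscl :: "'k \<Rightarrow> 'h \<Rightarrow> 'h"
  emb :: "'h \<Rightarrow> 'g"             \<comment> \<open>the inclusion of the Cartan subalgebra\<close>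
  cmat :: "'i \<Rightarrow> 'i \<Rightarrow> 'k"      \<comment> \<open>the Cartan matrix A\<close>
  symm :: "'i \<Rightarrow> 'k"            \<comment> \<open>diagonal of a matrix D such that DA is symmetric\<close>
  par :: "'i \<Rightarrow> bit"           \<comment> \<open>parities of the simple roots\<close>
  coroot :: "'i \<Rightarrow> 'h"
  sroot :: "'i \<Rightarrow> 'h \<Rightarrow> 'k"
  evec :: "'i \<Rightarrow> 'g"
  fvec :: "'i \<Rightarrow> 'g"

definition koszul :: "bit \<Rightarrow> bit \<Rightarrow> 'k::comm_ring_1" where
  "koszul p q = (if p = 1 \<and> q = 1 then - 1 else 1)"

definition lie_superalgebra ::
  "('k::field, 'g::ab_group_add, 'h, 'i) superdata \<Rightarrow> bool" where
  "lie_superalgebra G \<longleftrightarrow>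
     vector_space (scl G) \<and>
     (\<forall>p. Modules.module.subspace (scl G) (grade G p)) \<and>
     grade G 0 \<inter> grade G 1 = {0} \<and>
     (\<forall>x. \<exists>a\<in>grade G 0. \<exists>b\<in>grade G 1. x = a + b) \<and>
     (\<forall>x. Vector_Spaces.linear (scl G) (scl G) (brk G x)) \<and>
     (\<forall>y. Vector_Spaces.linear (scl G) (scl G) (\<lambda>x. brk G x y)) \<and>
     (\<forall>p q. \<forall>x\<in>grade G p. \<forall>y\<in>grade G q. brk G x y \<in> grade G (p + q)) \<and>
     (\<forall>p q. \<forall>x\<in>grade G p. \<forall>y\<in>grade G q.
        brk G x y = scl G (- koszul p q) (brk G y x)) \<and>
     (\<forall>p q. \<forall>x\<in>grade G p. \<forall>y\<in>grade G q. \<forall>z.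
        brk G x (brk G y z) = brk G (brk G x y) z + scl G (koszul p q) (brk G y (brk G x z)))"

subsection \<open>The contragredient Lie superalgebra of a Cartan matrix\<close>

text \<open>
  A minimal realization of the Cartan matrix: linearly independent coroots and simple roots with
  the simple root j taking the value A i j on the coroot i, and dim h = 2n - rank A.
\<close>

definition minimal_realization ::
  "('k::field, 'g, 'h::ab_group_add, 'i::finite) superdata \<Rightarrow> bool" where
  "minimal_realization G \<longleftrightarrow>
     vector_space (hscl G) \<and>
     (\<exists>B. finite B \<and> Modules.module.span (hscl G) B = UNIV) \<and>
     (\<forall>i. Vector_Spaces.linear (hscl G) (*) (sroot G i)) \<and>
     (\<forall>i j. sroot G j (coroot G i) = cmat G i j) \<and>
     (\<forall>c. (\<Sum>i\<in>UNIV. hscl G (c i) (coroot G i)) = 0 \<longrightarrow> (\<forall>i. c i = 0)) \<and>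
     (\<forall>c. (\<forall>x. (\<Sum>i\<in>UNIV. c i * sroot G i x) = 0) \<longrightarrow> (\<forall>i. c i = 0)) \<and>
     vector_space.dim (hscl G) (UNIV :: 'h set) + rank (\<chi> i j. cmat G i j) = 2 * CARD('i)"

text \<open>
  The free nonassociative algebra on a set of generators has the nonassociative monomials as a
  basis.
\<close>

datatype 'x monomial = Leaf 'x | Node "'x monomial" "'x monomial"

datatype ('i, 'h) chevalley = E 'i | F 'i | H 'h

definition na_scl :: "'k::comm_ring_1 \<Rightarrow> ('x monomial \<Rightarrow>\<^sub>0 'k) \<Rightarrow> ('x monomial \<Rightarrow>\<^sub>0 'k)" where
  "na_scl c a = Poly_Mapping.map ((*) c) a"

definition na_brk ::
  "('x monomial \<Rightarrow>\<^sub>0 'k::comm_ring_1) \<Rightarrow> ('x monomial \<Rightarrow>\<^sub>0 'k) \<Rightarrow> ('x monomial \<Rightarrow>\<^sub>0 'k)" where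
  "na_brk a b = (\<Sum>u\<in>Poly_Mapping.keys a. \<Sum>v\<in>Poly_Mapping.keys b.
     Poly_Mapping.single (Node u v) (Poly_Mapping.lookup a u * Poly_Mapping.lookup b v))"

definition na_ideal :: "('x monomial \<Rightarrow>\<^sub>0 'k::comm_ring_1) set \<Rightarrow> bool" where
  "na_ideal K \<longleftrightarrow> Modules.module.subspace na_scl K \<and>
     (\<forall>a. \<forall>b\<in>K. na_brk a b \<in> K \<and> na_brk b a \<in> K)"

abbreviation na_mono :: "'x monomial \<Rightarrow> ('x monomial \<Rightarrow>\<^sub>0 'k::comm_ring_1)" where
  "na_mono u \<equiv> Poly_Mapping.single u 1"

abbreviation leaf :: "'x \<Rightarrow> ('x monomial \<Rightarrow>\<^sub>0 'k::comm_ring_1)" where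
  "leaf x \<equiv> na_mono (Leaf x)"

fun mono_par :: "('i \<Rightarrow> bit) \<Rightarrow> ('i, 'h) chevalley monomial \<Rightarrow> bit" where
  "mono_par p (Leaf (E i)) = p i"
| "mono_par p (Leaf (F i)) = p i"
| "mono_par p (Leaf (H x)) = 0"
| "mono_par p (Node u v) = mono_par p u + mono_par p v"

definition super_lie_rels :: "('i \<Rightarrow> bit) \<Rightarrow> (('i, 'h) chevalley monomial \<Rightarrow>\<^sub>0 'k::comm_ring_1) set" where
  "super_lie_rels p =
     {na_mono (Node u v) + na_scl (koszul (mono_par p u) (mono_par p v)) (na_mono (Node v u)) | u v. True} \<union>
     {na_mono (Node u (Node v w)) - na_mono (Node (Node u v) w)
        - na_scl (koszul (mono_par p u) (mono_par p v)) (na_mono (Node v (Node u w))) | u v w. True}"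

definition chevalley_rels ::
  "('k::field, 'g, 'h::ab_group_add, 'i) superdata \<Rightarrow> (('i, 'h) chevalley monomial \<Rightarrow>\<^sub>0 'k) set" where
  "chevalley_rels G =
     {leaf (H (x + y)) - leaf (H x) - leaf (H y) | x y. True} \<union>
     {leaf (H (hscl G c x)) - na_scl c (leaf (H x)) | c x. True} \<union>
     {na_brk (leaf (H x)) (leaf (H y)) | x y. True} \<union>
     {na_brk (leaf (H x)) (leaf (E i)) - na_scl (sroot G i x) (leaf (E i)) | x i. True} \<union>
     {na_brk (leaf (H x)) (leaf (F i)) + na_scl (sroot G i x) (leaf (F i)) | x i. True} \<union>
     {na_brk (leaf (E i)) (leaf (F i)) - leaf (H (coroot G i)) | i. True} \<union>
     {na_brk (leaf (E i)) (leaf (F j)) | i j. i \<noteq> j}"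

text \<open>
  The free nonassociative algebra modulo the following ideal is the auxiliary Lie superalgebra
  presented by the Chevalley generators and relations.
\<close>

definition presentation_ideal ::
  "('k::field, 'g, 'h::ab_group_add, 'i) superdata \<Rightarrow> (('i, 'h) chevalley monomial \<Rightarrow>\<^sub>0 'k) set" where
  "presentation_ideal G = na_ideal hull (super_lie_rels (par G) \<union> chevalley_rels G)"

text \<open>
  The preimage of the largest ideal of the auxiliary Lie superalgebra that meets the Cartan
  subalgebra trivially, as the sum of all such ideals.
\<close>

definition maximal_ideal ::
  "('k::field, 'g, 'h::ab_group_add, 'i) superdata \<Rightarrow> (('i, 'h) chevalley monomial \<Rightarrow>\<^sub>0 'k) set" where
  "maximal_ideal G = Modules.module.span na_scl
     (\<Union>{K. na_ideal K \<and> presentation_ideal G \<subseteq> K \<and>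
           (\<forall>x. leaf (H x) \<in> K \<longrightarrow> leaf (H x) \<in> presentation_ideal G)})"

definition contragredient ::
  "('k::field, 'g::ab_group_add, 'h::ab_group_add, 'i::finite) superdata \<Rightarrow> bool" where
  "contragredient G \<longleftrightarrow>
     lie_superalgebra G \<and> minimal_realization G \<and>
     (\<forall>i. evec G i \<in> grade G (par G i) \<and> fvec G i \<in> grade G (par G i)) \<and>
     range (emb G) \<subseteq> grade G 0 \<and>
     (\<exists>\<phi>. Vector_Spaces.linear na_scl (scl G) \<phi> \<and> surj \<phi> \<and>
        (\<forall>a b. \<phi> (na_brk a b) = brk G (\<phi> a) (\<phi> b)) \<and>
        (\<forall>i. \<phi> (leaf (E i)) = evec G i) \<and> (\<forall>i. \<phi> (leaf (F i)) = fvec G i) \<and>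
        (\<forall>x. \<phi> (leaf (H x)) = emb G x) \<and>
        {a. \<phi> a = 0} = maximal_ideal G)"

definition symmetrizable :: "('k::field, 'g, 'h, 'i) superdata \<Rightarrow> bool" where
  "symmetrizable G \<longleftrightarrow>
     (\<forall>i. symm G i \<noteq> 0) \<and> (\<forall>i j. symm G i * cmat G i j = symm G j * cmat G j i)"

subsection \<open>Roots\<close>

definition root_space ::
  "('k::field, 'g, 'h, 'i) superdata \<Rightarrow> ('h \<Rightarrow> 'k) \<Rightarrow> 'g set" where
  "root_space G \<delta> = {x. \<forall>h. brk G (emb G h) x = scl G (\<delta> h) x}"

definition is_root ::
  "('k::field, 'g::zero, 'h, 'i) superdata \<Rightarrow> ('h \<Rightarrow> 'k) \<Rightarrow> bool" where
  "is_root G \<delta> \<longleftrightarrow> (\<exists>h. \<delta> h \<noteq> 0) \<and> (\<exists>x\<in>root_space G \<delta>. x \<noteq> 0)"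

definition positive_root ::
  "('k::field, 'g::zero, 'h, 'i::finite) superdata \<Rightarrow> ('h \<Rightarrow> 'k) \<Rightarrow> bool" where
  "positive_root G \<delta> \<longleftrightarrow> is_root G \<delta> \<and>
     (\<exists>c :: 'i \<Rightarrow> nat. \<delta> = (\<lambda>h. \<Sum>i\<in>UNIV. of_nat (c i) * sroot G i h))"

definition nminus ::
  "('k::field, 'g::ab_group_add, 'h, 'i::finite) superdata \<Rightarrow> 'g set" where
  "nminus G = Modules.module.span (scl G) (\<Union>\<delta>\<in>Collect (positive_root G). root_space G (\<lambda>h. - \<delta> h))"

text \<open>
  The bilinear form on the span of the simple roots (which contains all roots) whose Gram matrix
  in the basis of simple roots is DA.
\<close>

definition root_coord ::
  "('k::field, 'g, 'h, 'i::finite) superdata \<Rightarrow> ('h \<Rightarrow> 'k) \<Rightarrow> 'i \<Rightarrow> 'k" where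
  "root_coord G \<delta> = (SOME c. \<delta> = (\<lambda>h. \<Sum>i\<in>UNIV. c i * sroot G i h))"

definition root_form ::
  "('k::field, 'g, 'h, 'i::finite) superdata \<Rightarrow> ('h \<Rightarrow> 'k) \<Rightarrow> ('h \<Rightarrow> 'k) \<Rightarrow> 'k" where
  "root_form G \<delta> \<epsilon> =
     (\<Sum>i\<in>UNIV. \<Sum>j\<in>UNIV. root_coord G \<delta> i * root_coord G \<epsilon> j * (symm G i * cmat G i j))"

definition nonisotropic ::
  "('k::field, 'g, 'h, 'i::finite) superdata \<Rightarrow> ('h \<Rightarrow> 'k) \<Rightarrow> bool" where
  "nonisotropic G \<delta> \<longleftrightarrow> root_form G \<delta> \<delta> \<noteq> 0"

definition root_reflection ::
  "('k::field, 'g, 'h, 'i::finite) superdata \<Rightarrow> ('h \<Rightarrow> 'k) \<Rightarrow> ('h \<Rightarrow> 'k) \<Rightarrow> ('h \<Rightarrow> 'k)" where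
  "root_reflection G \<alpha> \<delta> = (\<lambda>h. \<delta> h - 2 * root_form G \<delta> \<alpha> / root_form G \<alpha> \<alpha> * \<alpha> h)"

text \<open>
  The reflections are involutions, so the orbit under the group that they generate is the closure
  under the reflections.
\<close>

inductive real_root ::
  "('k::field, 'g, 'h, 'i::finite) superdata \<Rightarrow> ('h \<Rightarrow> 'k) \<Rightarrow> bool" for G where
  simple: "real_root G (sroot G i)"
| reflect: "real_root G \<delta> \<Longrightarrow> nonisotropic G (sroot G i) \<Longrightarrow>
    real_root G (root_reflection G (sroot G i) \<delta>)"

section \<open>Free, enveloping and symmetric algebras\<close>

text \<open>Finitely supported functions on words form the free associative algebra.\<close>

datatype 'x word = Word (letters: "'x list")

instantiation word :: (type) monoid_add
begin

definition zero_word :: "'a word" where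
  "zero_word = Word []"

definition plus_word :: "'a word \<Rightarrow> 'a word \<Rightarrow> 'a word" where
  "plus_word u v = Word (letters u @ letters v)"

instance
  by standard (simp_all add: zero_word_def plus_word_def)

end

abbreviation letter :: "'x \<Rightarrow> ('x word \<Rightarrow>\<^sub>0 'k::comm_ring_1)" where
  "letter x \<equiv> Poly_Mapping.single (Word [x]) 1"

abbreviation const :: "'k::comm_ring_1 \<Rightarrow> ('x word \<Rightarrow>\<^sub>0 'k)" where
  "const c \<equiv> Poly_Mapping.single 0 c"

definition free_alg :: "'x set \<Rightarrow> ('x word \<Rightarrow>\<^sub>0 'k::comm_ring_1) ring" where
  "free_alg V = \<lparr>carrier = {a. \<forall>w\<in>Poly_Mapping.keys a. set (letters w) \<subseteq> V},
     mult = (*), one = 1, zero = 0, add = (+)\<rparr>"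

text \<open>Modulo these relations, the free algebra on a subspace V becomes the tensor algebra of V.\<close>

definition linear_rels ::
  "('k::field, 'g::ab_group_add, 'h, 'i) superdata \<Rightarrow> 'g set \<Rightarrow> ('g word \<Rightarrow>\<^sub>0 'k) set" where
  "linear_rels G V =
     {letter (x + y) - letter x - letter y | x y. x \<in> V \<and> y \<in> V} \<union>
     {letter (scl G c x) - const c * letter x | c x. x \<in> V}"

definition sym_ideal ::
  "('k::field, 'g::ab_group_add, 'h, 'i) superdata \<Rightarrow> 'g set \<Rightarrow> ('g word \<Rightarrow>\<^sub>0 'k) set" where
  "sym_ideal G V = Idl\<^bsub>free_alg V\<^esub> (linear_rels G V \<union>
     {letter x * letter y - const (koszul p q) * letter y * letter x | x y p q.
        x \<in> V \<inter> grade G p \<and> y \<in> V \<inter> grade G q})"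

definition sym_alg ::
  "('k::field, 'g::ab_group_add, 'h, 'i) superdata \<Rightarrow> 'g set \<Rightarrow> ('g word \<Rightarrow>\<^sub>0 'k) set ring" where
  "sym_alg G V = free_alg V Quot sym_ideal G V"

definition env_ideal ::
  "('k::field, 'g::ab_group_add, 'h, 'i) superdata \<Rightarrow> ('g word \<Rightarrow>\<^sub>0 'k) set" where
  "env_ideal G = Idl\<^bsub>free_alg UNIV\<^esub> (linear_rels G UNIV \<union>
     {letter x * letter y - const (koszul p q) * letter y * letter x - letter (brk G x y) | x y p q.
        x \<in> grade G p \<and> y \<in> grade G q})"

definition env_alg ::
  "('k::field, 'g::ab_group_add, 'h, 'i) superdata \<Rightarrow> ('g word \<Rightarrow>\<^sub>0 'k) set ring" where
  "env_alg G = free_alg UNIV Quot env_ideal G"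

definition env_const ::
  "('k::field, 'g::ab_group_add, 'h, 'i) superdata \<Rightarrow> 'k \<Rightarrow> ('g word \<Rightarrow>\<^sub>0 'k) set" where
  "env_const G c = env_ideal G +>\<^bsub>free_alg UNIV\<^esub> const c"

subsection \<open>The adjoint action on the enveloping algebra and Z-forms\<close>

definition parity_involution ::
  "('k::field, 'g::ab_group_add, 'h, 'i) superdata \<Rightarrow> 'g \<Rightarrow> 'g" where
  "parity_involution G x = (THE y. \<exists>a\<in>grade G 0. \<exists>b\<in>grade G 1. x = a + b \<and> y = a - b)"

definition twist ::
  "('k::field, 'g::ab_group_add, 'h, 'i) superdata \<Rightarrow> bit \<Rightarrow> ('g word \<Rightarrow>\<^sub>0 'k) \<Rightarrow> ('g word \<Rightarrow>\<^sub>0 'k)" where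
  "twist G p a = (if p = 0 then a else
     \<Sum>w\<in>Poly_Mapping.keys a. Poly_Mapping.single
       (Word (map (parity_involution G) (letters w))) (Poly_Mapping.lookup a w))"

text \<open>
  For x of parity p this is ad x u = x u - (-1)^(p |u|) u x, extended linearly to nonhomogeneous
  u: the sign is produced by the parity automorphism of the free algebra.
\<close>

definition env_ad ::
  "('k::field, 'g::ab_group_add, 'h, 'i) superdata \<Rightarrow> bit \<Rightarrow> 'g \<Rightarrow>
     ('g word \<Rightarrow>\<^sub>0 'k) set \<Rightarrow> ('g word \<Rightarrow>\<^sub>0 'k) set" where
  "env_ad G p x X =
     (\<Union>a\<in>X. env_ideal G +>\<^bsub>free_alg UNIV\<^esub> (letter x * a - twist G p a * letter x))"

definition coefficients :: "'a set \<Rightarrow> ('a \<Rightarrow> 'k::zero) set" where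
  "coefficients B = {c. finite {b. c b \<noteq> 0} \<and> {b. c b \<noteq> 0} \<subseteq> B}"

definition combination ::
  "('k::zero \<Rightarrow> 'a) \<Rightarrow> ('a, 'm) ring_scheme \<Rightarrow> ('a \<Rightarrow> 'k) \<Rightarrow> 'a" where
  "combination \<kappa> R c = (\<Oplus>\<^bsub>R\<^esub> b \<in> {b. c b \<noteq> 0}. \<kappa> (c b) \<otimes>\<^bsub>R\<^esub> b)"

text \<open>
  For an algebra R with structure map \<open>\<kappa>\<close>: a Z-form of R is a subring that is the Z-span of a
  basis of R.
\<close>

definition Z_form ::
  "('k::field_char_0 \<Rightarrow> 'a) \<Rightarrow> ('a, 'm) ring_scheme \<Rightarrow> 'a set \<Rightarrow> bool" where
  "Z_form \<kappa> R W \<longleftrightarrow> subring W R \<and>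
     (\<exists>B\<subseteq>carrier R. bij_betw (combination \<kappa> R) (coefficients B) (carrier R) \<and>
        W = combination \<kappa> R ` {c \<in> coefficients B. range c \<subseteq> \<int>})"

definition divided_power_stable ::
  "('k::field_char_0, 'g::ab_group_add, 'h, 'i) superdata \<Rightarrow> bit \<Rightarrow> 'g \<Rightarrow>
     ('g word \<Rightarrow>\<^sub>0 'k) set set \<Rightarrow> bool" where
  "divided_power_stable G p x W \<longleftrightarrow>
     (\<forall>X\<in>W. \<forall>n. env_const G (1 / fact n) \<otimes>\<^bsub>env_alg G\<^esub> (env_ad G p x ^^ n) X \<in> W)"

text \<open>The standing assumptions on the Lie superalgebra.\<close>

definition kac_moody_superalgebra ::
  "('k::field_char_0, 'g::ab_group_add, 'h::ab_group_add, 'i::finite) superdata \<Rightarrow> bool" where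
  "kac_moody_superalgebra G \<longleftrightarrow>
     contragredient G \<and> symmetrizable G \<and>
     (\<forall>\<delta>. is_root G \<delta> \<and> nonisotropic G \<delta> \<longrightarrow>
        (\<forall>x\<in>root_space G \<delta>. \<forall>y. \<exists>n. (brk G x ^^ n) y = 0)) \<and>
     (\<exists>W. Z_form (env_const G) (env_alg G) W \<and>
        (\<forall>i. nonisotropic G (sroot G i) \<longrightarrow>
           divided_power_stable G (par G i) (evec G i) W \<and>
           divided_power_stable G (par G i) (fvec G i) W))"

definition finite_dimensional :: "('k::field, 'g::ab_group_add, 'h, 'i) superdata \<Rightarrow> bool" where
  "finite_dimensional G \<longleftrightarrow> (\<exists>B. finite B \<and> Modules.module.span (scl G) B = UNIV)"

section \<open>Sapovalov algebras\<close>

subsection \<open>Localization at the powers of an element\<close>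

text \<open>
  The class of (s, m) is the fraction s / e^m. The operations below are those of the ring of
  fractions if e is central or nilpotent (in the latter case all fractions are equal). This
  covers the homogeneous elements of a supersymmetric algebra that come from V: even ones are
  central and odd ones have square 0.
\<close>

definition loc_rel :: "('a, 'm) ring_scheme \<Rightarrow> 'a \<Rightarrow> (('a \<times> nat) \<times> ('a \<times> nat)) set" where
  "loc_rel R e = {((s, m), (t, n)) | s m t n. s \<in> carrier R \<and> t \<in> carrier R \<and>
     (\<exists>k::nat. e [^]\<^bsub>R\<^esub> k \<otimes>\<^bsub>R\<^esub> (e [^]\<^bsub>R\<^esub> n \<otimes>\<^bsub>R\<^esub> s \<ominus>\<^bsub>R\<^esub> e [^]\<^bsub>R\<^esub> m \<otimes>\<^bsub>R\<^esub> t) = \<zero>\<^bsub>R\<^esub>)}"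

definition frac :: "('a, 'm) ring_scheme \<Rightarrow> 'a \<Rightarrow> 'a \<Rightarrow> nat \<Rightarrow> ('a \<times> nat) set" where
  "frac R e s m = loc_rel R e `` {(s, m)}"

definition localization :: "('a, 'm) ring_scheme \<Rightarrow> 'a \<Rightarrow> ('a \<times> nat) set ring" where
  "localization R e =
     \<lparr>carrier = {frac R e s m | s m. s \<in> carrier R},
      mult = (\<lambda>X Y. \<Union>(s, m)\<in>X. \<Union>(t, n)\<in>Y. frac R e (s \<otimes>\<^bsub>R\<^esub> t) (m + n)),
      one = frac R e \<one>\<^bsub>R\<^esub> 0,
      zero = frac R e \<zero>\<^bsub>R\<^esub> 0,
      add = (\<lambda>X Y. \<Union>(s, m)\<in>X. \<Union>(t, n)\<in>Y.
        frac R e (e [^]\<^bsub>R\<^esub> n \<otimes>\<^bsub>R\<^esub> s \<oplus>\<^bsub>R\<^esub> e [^]\<^bsub>R\<^esub> m \<otimes>\<^bsub>R\<^esub> t) (m + n))\<rparr>"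

subsection \<open>Weights\<close>

text \<open>The derivation of the free algebra that extends the adjoint action of h.\<close>

definition h_act ::
  "('k::field, 'g, 'h, 'i) superdata \<Rightarrow> 'h \<Rightarrow> ('g word \<Rightarrow>\<^sub>0 'k) \<Rightarrow> ('g word \<Rightarrow>\<^sub>0 'k)" where
  "h_act G h a = (\<Sum>w\<in>Poly_Mapping.keys a. \<Sum>l<length (letters w). Poly_Mapping.single
     (Word ((letters w)[l := brk G (emb G h) (letters w ! l)])) (Poly_Mapping.lookup a w))"

definition sym_weight ::
  "('k::field, 'g::ab_group_add, 'h, 'i::finite) superdata \<Rightarrow> ('h \<Rightarrow> 'k) \<Rightarrow>
     ('g word \<Rightarrow>\<^sub>0 'k) set set" where
  "sym_weight G \<mu> = {X \<in> carrier (sym_alg G (nminus G)).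
     \<forall>a\<in>X. \<forall>h. h_act G h a - const (\<mu> h) * a \<in> sym_ideal G (nminus G)}"

definition sym_elem ::
  "('k::field, 'g::ab_group_add, 'h, 'i::finite) superdata \<Rightarrow> ('g word \<Rightarrow>\<^sub>0 'k) \<Rightarrow>
     ('g word \<Rightarrow>\<^sub>0 'k) set" where
  "sym_elem G a = sym_ideal G (nminus G) +>\<^bsub>free_alg (nminus G)\<^esub> a"

definition sym_loc ::
  "('k::field, 'g::ab_group_add, 'h, 'i::finite) superdata \<Rightarrow> 'g \<Rightarrow>
     (('g word \<Rightarrow>\<^sub>0 'k) set \<times> nat) set ring" where
  "sym_loc G e = localization (sym_alg G (nminus G)) (sym_elem G (letter e))"

definition sym_loc_const ::
  "('k::field, 'g::ab_group_add, 'h, 'i::finite) superdata \<Rightarrow> 'g \<Rightarrow> 'k \<Rightarrow>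
     (('g word \<Rightarrow>\<^sub>0 'k) set \<times> nat) set" where
  "sym_loc_const G e c = frac (sym_alg G (nminus G)) (sym_elem G (letter e)) (sym_elem G (const c)) 0"

text \<open>
  Here e has weight \<open>-\<alpha>\<close>, so that s / e^m has weight \<open>\<mu>\<close> if s has weight \<open>\<mu> - m\<alpha>\<close>.
\<close>

definition sym_loc_weight ::
  "('k::field, 'g::ab_group_add, 'h, 'i::finite) superdata \<Rightarrow> ('h \<Rightarrow> 'k) \<Rightarrow> 'g \<Rightarrow> ('h \<Rightarrow> 'k) \<Rightarrow>
     (('g word \<Rightarrow>\<^sub>0 'k) set \<times> nat) set set" where
  "sym_loc_weight G \<alpha> e \<mu> =
     {frac (sym_alg G (nminus G)) (sym_elem G (letter e)) s m | s m.
        s \<in> sym_weight G (\<lambda>h. \<mu> h - of_nat m * \<alpha> h)}"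

text \<open>
  The direct sum of the weight spaces of weight \<open>-m\<tau>\<close>, as a subalgebra of the localization; the
  sum is direct because \<open>\<tau>\<close> is a root, hence nonzero.
\<close>

definition sapovalov_algebra ::
  "('k::field, 'g::ab_group_add, 'h, 'i::finite) superdata \<Rightarrow> ('h \<Rightarrow> 'k) \<Rightarrow> 'g \<Rightarrow> ('h \<Rightarrow> 'k) \<Rightarrow>
     (('g word \<Rightarrow>\<^sub>0 'k) set \<times> nat) set ring" where
  "sapovalov_algebra G \<alpha> e \<tau> = (sym_loc G e)
     \<lparr>carrier := {\<Oplus>\<^bsub>sym_loc G e\<^esub> m \<in> {..N}. x m | x (N::nat).
        \<forall>m\<le>N. x m \<in> sym_loc_weight G \<alpha> e (\<lambda>h. - (of_nat m * \<tau> h))}\<rparr>"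

definition finitely_generated_algebra ::
  "('k \<Rightarrow> 'a) \<Rightarrow> ('a, 'm) ring_scheme \<Rightarrow> bool" where
  "finitely_generated_algebra \<kappa> R \<longleftrightarrow>
     (\<exists>X. finite X \<and> X \<subseteq> carrier R \<and> generate_ring R (range \<kappa> \<union> X) = carrier R)"

end

theory Submission
  imports Defs
begin

text \<open>
The algebra \<open>S(n\<^sup>-)\<close> is generated by a finite set \<open>B\<close> of root vectors, each of which is even or odd.
Its localization at \<open>e\<close> is therefore spanned by the fractions \<open>w / e^m\<close> with \<open>w\<close> a word in \<open>B\<close>. Such
a fraction is a weight vector, and as the letters supercommute, it depends up to sign only on \<open>m\<close>
and on the multiset of letters of \<open>w\<close>. The fraction has weight \<open>- k\<tau>\<close> if the roots of the
letters add up to \<open>m\<alpha> + k\<tau>\<close>. The solutions of this homogeneous linear equation in natural numbers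
(the multiplicities of the letters, \<open>m\<close> and \<open>k\<close>) form a monoid that contains the difference of any
two of its elements one of which lies below the other. By Dickson's lemma such a monoid is
generated by its finitely many minimal nonzero elements
(\<open>difference_closed_finitely_generated\<close>), and the fractions of these solutions generate the
Sapovalov algebra (\<open>finitely_generated_sapovalov\<close>).

Three facts support this computation.

\<^item> A weight vector of \<open>S(n\<^sup>-)\<close> is a combination of words of its own weight (\<open>sym_weight_words\<close>).
This is the linear independence of weight vectors of different weights, applied modulo the ideal
that defines the supersymmetric algebra (\<open>other_weights_vanish\<close>).

\<^item> Root vectors are homogeneous for the parity (\<open>root_space_homogeneous\<close>): the simple roots are
linearly independent, so that the weight of a monomial in the Chevalley generators determines its
degree, and the degree determines its parity. Hence \<open>e\<close> is central or has square zero in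
\<open>S(n\<^sup>-)\<close>, and in both cases its fractions form a ring (locale \<open>fractions\<close>).

\<^item> The simple root \<open>\<alpha>\<close> is a root, so that \<open>e\<close> lies in \<open>n\<^sup>-\<close> (\<open>sroot_positive_root\<close>).
\<close>

section \<open>Monoids of multisets closed under differences\<close>

text \<open>
There is a monotone subsequence. If it decreases, it becomes constant where its least value is
attained.
\<close>

lemma nat_seq_incseq_subseq:
  fixes f :: "nat \<Rightarrow> nat"
  shows "\<exists>r::nat \<Rightarrow> nat. strict_mono r \<and> (\<forall>m n. m \<le> n \<longrightarrow> f (r m) \<le> f (r n))"
proof -
  obtain r :: "nat \<Rightarrow> nat" where r: "strict_mono r" "monoseq (\<lambda>n. f (r n))"
    using seq_monosub by blast
  show ?thesis
  proof (cases "\<forall>m n. m \<le> n \<longrightarrow> f (r m) \<le> f (r n)")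
    case True
    then show ?thesis using r by blast
  next
    case False
    then have dec: "f (r n) \<le> f (r m)" if "m \<le> n" for m n
      using r(2) that unfolding monoseq_def by blast
    define v where "v = (LEAST v. v \<in> range (\<lambda>n. f (r n)))"
    have "v \<in> range (\<lambda>n. f (r n))"
      unfolding v_def by (rule LeastI_ex) blast
    then obtain N where N: "v = f (r N)" by blast
    have "f (r (N + n)) = v" for n
      using dec[of N "N + n"] N Least_le[of "\<lambda>v. v \<in> range (\<lambda>n. f (r n))" "f (r (N + n))"]
      unfolding v_def by (simp add: order_antisym)
    moreover have "strict_mono (\<lambda>n. r (N + n))"
      using r(1) by (simp add: strict_mono_def)
    ultimately show ?thesis by (intro exI[of _ "\<lambda>n. r (N + n)"]) auto
  qed
qed

text \<open>
Dickson's lemma: the coordinates are made monotone one after the other, because a subsequence of a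
sequence that is monotone in one coordinate stays so.
\<close>

lemma dickson_subseq:
  fixes f :: "nat \<Rightarrow> 'b \<Rightarrow> nat"
  assumes "finite B"
  shows "\<exists>r::nat \<Rightarrow> nat. strict_mono r \<and> (\<forall>b\<in>B. \<forall>m n. m \<le> n \<longrightarrow> f (r m) b \<le> f (r n) b)"
  using assms
proof (induction B rule: finite_induct)
  case empty
  show ?case by (auto intro: exI[of _ id] simp: strict_mono_def)
next
  case (insert b B)
  then obtain r :: "nat \<Rightarrow> nat" where r: "strict_mono r" "\<And>b m n. b \<in> B \<Longrightarrow> m \<le> n \<Longrightarrow> f (r m) b \<le> f (r n) b"
    by blast
  obtain r' :: "nat \<Rightarrow> nat" where r': "strict_mono r'" "\<And>m n. m \<le> n \<Longrightarrow> f (r (r' m)) b \<le> f (r (r' n)) b"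
    using nat_seq_incseq_subseq[of "\<lambda>n. f (r n) b"] by blast
  have "strict_mono (r \<circ> r')" using r(1) r'(1) by (simp add: strict_mono_def)
  moreover have "f ((r \<circ> r') m) c \<le> f ((r \<circ> r') n) c" if "c \<in> insert b B" "m \<le> n" for c m n
    using that r(2) r' by (auto simp: strict_mono_less_eq)
  ultimately show ?case by blast
qed

lemma finite_antichain_multisets:
  fixes L :: "'b multiset set"
  assumes "finite B" and "\<And>M. M \<in> L \<Longrightarrow> set_mset M \<subseteq> B"
    and antichain: "\<And>M N. M \<in> L \<Longrightarrow> N \<in> L \<Longrightarrow> N \<subseteq># M \<Longrightarrow> N = M"
  shows "finite L"
proof (rule ccontr)
  assume "infinite L"
  then obtain f :: "nat \<Rightarrow> 'b multiset" where f: "inj f" "range f \<subseteq> L"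
    using infinite_countable_subset by blast
  obtain r :: "nat \<Rightarrow> nat" where r: "strict_mono r"
    "\<And>b m n. b \<in> B \<Longrightarrow> m \<le> n \<Longrightarrow> count (f (r m)) b \<le> count (f (r n)) b"
    using dickson_subseq[OF assms(1), of "\<lambda>n. count (f n)"] by blast
  have "count (f (r 0)) b \<le> count (f (r 1)) b" for b
  proof (cases "b \<in> B")
    case True
    then show ?thesis using r(2) by simp
  next
    case False
    then have "b \<notin># f (r 0)" using f(2) assms(2) by blast
    then show ?thesis by (simp add: not_in_iff)
  qed
  then have "f (r 0) = f (r 1)"
    using antichain f(2) by (simp add: image_subset_iff subseteq_mset_def)
  then have "r 0 = r 1" using f(1) by (simp add: inj_eq)
  then show False using r(1) by (simp add: strict_mono_eq)
qed

text \<open>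
The generators are the minimal nonempty members. They form an antichain, hence are finitely many.
A member that is not minimal splits into a smaller member and the difference, which is again a
member. Solution sets of homogeneous linear equations in natural numbers have this closure
property.
\<close>

lemma difference_closed_finitely_generated:
  fixes L :: "'b multiset set"
  assumes "finite B" and L: "\<And>M. M \<in> L \<Longrightarrow> set_mset M \<subseteq> B"
    and diff: "\<And>M N. M \<in> L \<Longrightarrow> N \<in> L \<Longrightarrow> N \<subseteq># M \<Longrightarrow> M - N \<in> L"
  obtains S where "finite S" "S \<subseteq> L"
    "\<And>M. M \<in> L \<Longrightarrow> \<exists>\<A>. set_mset \<A> \<subseteq> S \<and> M = \<Sum>\<^sub># \<A>"
proof
  define S where "S = {M \<in> L. M \<noteq> {#} \<and> (\<forall>N\<in>L. N \<noteq> {#} \<longrightarrow> N \<subseteq># M \<longrightarrow> N = M)}"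
  show "finite S"
    by (rule finite_antichain_multisets[OF assms(1)]) (use L in \<open>auto simp: S_def\<close>)
  show "S \<subseteq> L" by (auto simp: S_def)
  show "\<exists>\<A>. set_mset \<A> \<subseteq> S \<and> M = \<Sum>\<^sub># \<A>" if "M \<in> L" for M
    using that
  proof (induction "size M" arbitrary: M rule: less_induct)
    case less
    show ?case
    proof (cases "M = {#} \<or> M \<in> S")
      case True
      then show ?thesis
      proof
        assume "M = {#}"
        then show ?thesis by (intro exI[of _ "{#}"]) simp
      next
        assume "M \<in> S"
        then show ?thesis by (intro exI[of _ "{#M#}"]) simp
      qed
    next
      case False
      then obtain N where N: "N \<in> L" "N \<noteq> {#}" "N \<subset># M"
        using less.prems by (auto simp: S_def subset_mset.le_less)
      then have eq: "M = N + (M - N)" by (metis subset_mset.add_diff_inverse subset_mset.less_imp_le)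
      have "size N < size M" using N(3) by (rule mset_subset_size)
      moreover have "size (M - N) < size M"
        using N(2) eq by (metis less_add_same_cancel2 nonempty_has_size size_union)
      moreover have "M - N \<in> L" using diff less.prems N by (simp add: subset_mset.less_imp_le)
      ultimately obtain \<A> \<B> where "set_mset \<A> \<subseteq> S" "N = \<Sum>\<^sub># \<A>" "set_mset \<B> \<subseteq> S" "M - N = \<Sum>\<^sub># \<B>"
        using less.hyps N(1) by meson
      then show ?thesis using eq by (intro exI[of _ "\<A> + \<B>"]) auto
    qed
  qed
qed

section \<open>Rings of fractions\<close>

text \<open>
The two alternatives are those of an even and of an odd element of a supersymmetric algebra. In the
first case this is the usual ring of fractions; in the second case all fractions coincide, and the
ring of fractions is trivial.
\<close>

locale fractions = ring R for R :: "('a, 'm) ring_scheme" (structure) +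
  fixes e
  assumes e_closed [simp]: "e \<in> carrier R"
    and central_or_square_zero: "(\<forall>x\<in>carrier R. x \<otimes> e = e \<otimes> x) \<or> e \<otimes> e = \<zero>"
begin

abbreviation fr :: "'a \<Rightarrow> nat \<Rightarrow> ('a \<times> nat) set" where "fr \<equiv> frac R e"

abbreviation Loc :: "('a \<times> nat) set ring" where "Loc \<equiv> localization R e"

lemma pow_pow [simp]: "x \<in> carrier R \<Longrightarrow> e [^] (m::nat) \<otimes> (e [^] (n::nat) \<otimes> x) = e [^] (m + n) \<otimes> x"
  by (simp add: m_assoc[symmetric] nat_pow_mult)

text \<open>
Without the subtraction, equality of fractions is transitive by adding the exponents of the two
witnesses, since powers of \<open>e\<close> commute with each other.
\<close>

lemma loc_rel_iff:
  "((s, m), (t, n)) \<in> loc_rel R e \<longleftrightarrow> s \<in> carrier R \<and> t \<in> carrier R \<and>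
     (\<exists>k::nat. e [^] (k + n) \<otimes> s = e [^] (k + m) \<otimes> t)"
proof -
  have "e [^] k \<otimes> (e [^] n \<otimes> s \<ominus> e [^] m \<otimes> t) = \<zero> \<longleftrightarrow> e [^] (k + n) \<otimes> s = e [^] (k + m) \<otimes> t"
    if "s \<in> carrier R" "t \<in> carrier R" for k :: nat
  proof -
    have "e [^] k \<otimes> (e [^] n \<otimes> s \<ominus> e [^] m \<otimes> t) = e [^] (k + n) \<otimes> s \<ominus> e [^] (k + m) \<otimes> t"
      using that by (simp add: r_distr r_minus a_minus_def)
    then show ?thesis using that by simp
  qed
  then show ?thesis unfolding loc_rel_def by auto
qed

lemma equiv_loc_rel: "equiv (carrier R \<times> UNIV) (loc_rel R e)"
proof (rule equivI)
  show "loc_rel R e \<subseteq> (carrier R \<times> UNIV) \<times> carrier R \<times> UNIV"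
    unfolding loc_rel_def by auto
  show "refl_on (carrier R \<times> UNIV) (loc_rel R e)"
    by (auto simp: refl_on_def loc_rel_iff)
  show "sym (loc_rel R e)"
    unfolding sym_def by (auto simp: loc_rel_iff) metis
  show "trans (loc_rel R e)"
  proof (rule transI, clarify)
    fix s m t n u p assume "((s, m), (t, n)) \<in> loc_rel R e" "((t, n), (u, p)) \<in> loc_rel R e"
    then obtain k l :: nat where c: "s \<in> carrier R" "t \<in> carrier R" "u \<in> carrier R"
      and k: "e [^] (k + n) \<otimes> s = e [^] (k + m) \<otimes> t"
      and l: "e [^] (l + p) \<otimes> t = e [^] (l + n) \<otimes> u"
      by (auto simp: loc_rel_iff)
    have "e [^] (k + l + n + p) \<otimes> s = e [^] (l + p) \<otimes> (e [^] (k + n) \<otimes> s)"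
      using c by (simp add: add_ac)
    also have "\<dots> = e [^] (k + m) \<otimes> (e [^] (l + p) \<otimes> t)"
      unfolding k using c by (simp add: add_ac)
    also have "\<dots> = e [^] (k + l + n + m) \<otimes> u"
      unfolding l using c by (simp add: add_ac)
    finally show "((s, m), (u, p)) \<in> loc_rel R e" using c by (auto simp: loc_rel_iff)
  qed
qed

lemma fr_eq_iff:
  "s \<in> carrier R \<Longrightarrow> t \<in> carrier R \<Longrightarrow>
     fr s m = fr t n \<longleftrightarrow> (\<exists>k::nat. e [^] (k + n) \<otimes> s = e [^] (k + m) \<otimes> t)"
  unfolding frac_def using eq_equiv_class_iff[OF equiv_loc_rel, of "(s, m)" "(t, n)"]
  by (simp add: loc_rel_iff)

lemma fr_eqI: "s \<in> carrier R \<Longrightarrow> t \<in> carrier R \<Longrightarrow> e [^] n \<otimes> s = e [^] m \<otimes> t \<Longrightarrow> fr s m = fr t n"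
  by (auto simp: fr_eq_iff intro!: exI[of _ 0])

lemma fr_expand: "s \<in> carrier R \<Longrightarrow> fr (e [^] k \<otimes> s) (k + m) = fr s m"
  by (rule fr_eqI) (simp_all add: add_ac)

lemma mem_fr: "(t, n) \<in> fr s m \<longleftrightarrow> s \<in> carrier R \<and> t \<in> carrier R \<and> fr s m = fr t n"
proof
  assume "(t, n) \<in> fr s m"
  then show "s \<in> carrier R \<and> t \<in> carrier R \<and> fr s m = fr t n"
    unfolding frac_def using equiv_class_eq[OF equiv_loc_rel] by (auto simp: loc_rel_def)
next
  assume *: "s \<in> carrier R \<and> t \<in> carrier R \<and> fr s m = fr t n"
  then have "(t, n) \<in> fr t n"
    unfolding frac_def using equiv_class_self[OF equiv_loc_rel, of "(t, n)"] by simp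
  then show "(t, n) \<in> fr s m" using * by simp
qed

text \<open>
An identity of fractions is trivial in the first case. In the second case powers of \<open>e\<close> can be
collected on the left.
\<close>

lemma cases_central [case_names square_zero central]:
  assumes "(\<And>s t m n. s \<in> carrier R \<Longrightarrow> t \<in> carrier R \<Longrightarrow> fr s m = fr t n) \<Longrightarrow> P"
    and "(\<And>x y n. x \<in> carrier R \<Longrightarrow> y \<in> carrier R \<Longrightarrow>
             x \<otimes> (e [^] (n::nat) \<otimes> y) = e [^] n \<otimes> (x \<otimes> y)) \<Longrightarrow> P"
  shows P
proof (cases "e \<otimes> e = \<zero>")
  case True
  have "fr s m = fr t n" if "s \<in> carrier R" "t \<in> carrier R" for s t m n
  proof -
    have "e [^] (2 + k) \<otimes> x = \<zero>" if "x \<in> carrier R" for x and k :: nat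
    proof -
      have "e [^] (2 + k) = e [^] k \<otimes> (e \<otimes> e)"
        by (simp add: m_assoc)
      then show ?thesis using True that by simp
    qed
    then show ?thesis using that by (auto simp: fr_eq_iff intro!: exI[of _ 2])
  qed
  then show P by (rule assms(1))
next
  case False
  then have c: "x \<otimes> e = e \<otimes> x" if "x \<in> carrier R" for x
    using central_or_square_zero that by blast
  have "x \<otimes> e [^] n = e [^] n \<otimes> x" if "x \<in> carrier R" for x and n :: nat
  proof (induction n)
    case (Suc n)
    have "x \<otimes> (e [^] n \<otimes> e) = (e [^] n \<otimes> x) \<otimes> e"
      using that Suc by (simp add: m_assoc[symmetric])
    also have "\<dots> = (e [^] n \<otimes> e) \<otimes> x" using that c by (simp add: m_assoc)
    finally show ?case by simp
  qed (use that in simp)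
  then show P using assms(2) by (simp add: m_assoc[symmetric])
qed

lemma fr_mult_cong:
  assumes "fr s m = fr s' m'" "fr t n = fr t' n'"
    and c: "s \<in> carrier R" "s' \<in> carrier R" "t \<in> carrier R" "t' \<in> carrier R"
  shows "fr (s \<otimes> t) (m + n) = fr (s' \<otimes> t') (m' + n')"
proof (cases rule: cases_central)
  case square_zero
  then show ?thesis using c by simp
next
  case central
  obtain k l :: nat where k: "e [^] (k + m') \<otimes> s = e [^] (k + m) \<otimes> s'"
    and l: "e [^] (l + n') \<otimes> t = e [^] (l + n) \<otimes> t'"
    using assms by (auto simp: fr_eq_iff)
  have "e [^] ((k + l) + (m' + n')) \<otimes> (s \<otimes> t) = e [^] (l + n') \<otimes> ((e [^] (k + m') \<otimes> s) \<otimes> t)"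
    using c by (simp add: m_assoc add_ac)
  also have "\<dots> = (e [^] (k + m) \<otimes> s') \<otimes> (e [^] (l + n') \<otimes> t)"
    unfolding k using c central by simp
  also have "\<dots> = e [^] (k + m) \<otimes> (s' \<otimes> (e [^] (l + n) \<otimes> t'))"
    unfolding l using c by (simp add: m_assoc)
  also have "\<dots> = e [^] (k + m) \<otimes> (e [^] (l + n) \<otimes> (s' \<otimes> t'))"
    using c by (simp only: central)
  also have "\<dots> = e [^] ((k + l) + (m + n)) \<otimes> (s' \<otimes> t')"
    using c by (simp add: add_ac)
  finally show ?thesis using c by (subst fr_eq_iff) auto
qed

lemma fr_add_cong:
  assumes "fr s m = fr s' m'" "fr t n = fr t' n'"
    and c: "s \<in> carrier R" "s' \<in> carrier R" "t \<in> carrier R" "t' \<in> carrier R"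
  shows "fr (e [^] n \<otimes> s \<oplus> e [^] m \<otimes> t) (m + n) = fr (e [^] n' \<otimes> s' \<oplus> e [^] m' \<otimes> t') (m' + n')"
proof -
  obtain k l :: nat where k: "e [^] (k + m') \<otimes> s = e [^] (k + m) \<otimes> s'"
    and l: "e [^] (l + n') \<otimes> t = e [^] (l + n) \<otimes> t'"
    using assms by (auto simp: fr_eq_iff)
  have "e [^] ((k + l) + (m' + n')) \<otimes> (e [^] n \<otimes> s \<oplus> e [^] m \<otimes> t)
      = e [^] (l + n + n') \<otimes> (e [^] (k + m') \<otimes> s) \<oplus> e [^] (k + m + m') \<otimes> (e [^] (l + n') \<otimes> t)"
    using c by (simp add: r_distr add_ac)
  also have "\<dots> = e [^] ((k + l) + (m + n)) \<otimes> (e [^] n' \<otimes> s' \<oplus> e [^] m' \<otimes> t')"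
    unfolding k l using c by (simp add: r_distr add_ac)
  finally show ?thesis using c by (subst fr_eq_iff) auto
qed

lemma fr_closed [simp]: "s \<in> carrier R \<Longrightarrow> fr s m \<in> carrier Loc"
  by (auto simp: localization_def)

lemma Loc_cases:
  assumes "X \<in> carrier Loc"
  obtains s m where "s \<in> carrier R" "X = fr s m"
  using assms by (auto simp: localization_def)

lemma Loc_one: "\<one>\<^bsub>Loc\<^esub> = fr \<one> 0" and Loc_zero: "\<zero>\<^bsub>Loc\<^esub> = fr \<zero> 0"
  by (simp_all add: localization_def)

lemma Loc_mult:
  assumes "s \<in> carrier R" "t \<in> carrier R"
  shows "fr s m \<otimes>\<^bsub>Loc\<^esub> fr t n = fr (s \<otimes> t) (m + n)"
proof -
  have "(\<Union>(s', m')\<in>fr s m. \<Union>(t', n')\<in>fr t n. fr (s' \<otimes> t') (m' + n')) = fr (s \<otimes> t) (m + n)"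
    (is "?U = _")
  proof -
    have "fr (s' \<otimes> t') (m' + n') = fr (s \<otimes> t) (m + n)"
      if "(s', m') \<in> fr s m" "(t', n') \<in> fr t n" for s' m' t' n'
      using that fr_mult_cong[of s m s' m' t n t' n'] by (simp add: mem_fr)
    then have "?U = (\<Union>x\<in>fr s m. \<Union>y\<in>fr t n. fr (s \<otimes> t) (m + n))"
      by (intro SUP_cong refl) (auto split: prod.splits)
    also have "\<dots> = fr (s \<otimes> t) (m + n)"
    proof -
      have "(s, m) \<in> fr s m" "(t, n) \<in> fr t n" using assms by (simp_all add: mem_fr)
      then show ?thesis by blast
    qed
    finally show ?thesis .
  qed
  then show ?thesis by (simp add: localization_def)
qed

lemma Loc_add:
  assumes "s \<in> carrier R" "t \<in> carrier R"
  shows "fr s m \<oplus>\<^bsub>Loc\<^esub> fr t n = fr (e [^] n \<otimes> s \<oplus> e [^] m \<otimes> t) (m + n)"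
proof -
  have "(\<Union>(s', m')\<in>fr s m. \<Union>(t', n')\<in>fr t n. fr (e [^] n' \<otimes> s' \<oplus> e [^] m' \<otimes> t') (m' + n'))
      = fr (e [^] n \<otimes> s \<oplus> e [^] m \<otimes> t) (m + n)"
    (is "?U = _")
  proof -
    have "fr (e [^] n' \<otimes> s' \<oplus> e [^] m' \<otimes> t') (m' + n') = fr (e [^] n \<otimes> s \<oplus> e [^] m \<otimes> t) (m + n)"
      if "(s', m') \<in> fr s m" "(t', n') \<in> fr t n" for s' m' t' n'
      using that fr_add_cong[of s m s' m' t n t' n'] by (simp add: mem_fr)
    then have "?U = (\<Union>x\<in>fr s m. \<Union>y\<in>fr t n. fr (e [^] n \<otimes> s \<oplus> e [^] m \<otimes> t) (m + n))"
      by (intro SUP_cong refl) (auto split: prod.splits)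
    also have "\<dots> = fr (e [^] n \<otimes> s \<oplus> e [^] m \<otimes> t) (m + n)"
    proof -
      have "(s, m) \<in> fr s m" "(t, n) \<in> fr t n" using assms by (simp_all add: mem_fr)
      then show ?thesis by blast
    qed
    finally show ?thesis .
  qed
  then show ?thesis by (simp add: localization_def)
qed

lemma Loc_add_same:
  assumes "s \<in> carrier R" "t \<in> carrier R"
  shows "fr s m \<oplus>\<^bsub>Loc\<^esub> fr t m = fr (s \<oplus> t) m"
proof -
  have "fr s m \<oplus>\<^bsub>Loc\<^esub> fr t m = fr (e [^] m \<otimes> (s \<oplus> t)) (m + m)"
    using assms by (simp add: Loc_add r_distr)
  also have "\<dots> = fr (s \<oplus> t) m" using assms by (intro fr_expand) simp
  finally show ?thesis .
qed

lemma Loc_common_denominator: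
  assumes "X \<in> carrier Loc" "Y \<in> carrier Loc" 
  obtains s t m where "s \<in> carrier R" "t \<in> carrier R" "X = fr s m" "Y = fr t m"
proof -
  obtain s m where X: "s \<in> carrier R" "X = fr s m" using assms(1) by (rule Loc_cases)
  obtain t n where Y: "t \<in> carrier R" "Y = fr t n" using assms(2) by (rule Loc_cases)
  show ?thesis
  proof (rule that)
    show "X = fr (e [^] n \<otimes> s) (n + m)" using X by (simp add: fr_expand)
    show "Y = fr (e [^] m \<otimes> t) (n + m)" using Y by (simp add: fr_expand add.commute[of n])
  qed (use X Y in simp_all)
qed

lemma fr_zero: "fr \<zero> m = \<zero>\<^bsub>Loc\<^esub>"
  unfolding Loc_zero by (rule fr_eqI) simp_all

lemma ring_Loc: "ring Loc"
proof (rule ringI)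
  show "abelian_group Loc"
  proof (rule abelian_groupI)
    fix X Y assume XY: "X \<in> carrier Loc" "Y \<in> carrier Loc"
    obtain s t m where *: "s \<in> carrier R" "t \<in> carrier R" "X = fr s m" "Y = fr t m"
      using XY by (rule Loc_common_denominator)
    then show "X \<oplus>\<^bsub>Loc\<^esub> Y \<in> carrier Loc" "X \<oplus>\<^bsub>Loc\<^esub> Y = Y \<oplus>\<^bsub>Loc\<^esub> X"
      by (simp_all add: Loc_add_same a_comm)
    fix Z assume "Z \<in> carrier Loc"
    then obtain u p where "u \<in> carrier R" "Z = fr u p" by (rule Loc_cases)
    with * show "X \<oplus>\<^bsub>Loc\<^esub> Y \<oplus>\<^bsub>Loc\<^esub> Z = X \<oplus>\<^bsub>Loc\<^esub> (Y \<oplus>\<^bsub>Loc\<^esub> Z)"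
      by (simp add: Loc_add r_distr a_assoc add_ac)
  next
    show "\<zero>\<^bsub>Loc\<^esub> \<in> carrier Loc" by (simp add: Loc_zero)
  next
    fix X assume "X \<in> carrier Loc"
    then obtain s m where s: "s \<in> carrier R" "X = fr s m" by (rule Loc_cases)
    show "\<zero>\<^bsub>Loc\<^esub> \<oplus>\<^bsub>Loc\<^esub> X = X"
      using s fr_zero[of m, symmetric] by (simp add: Loc_add_same)
    show "\<exists>Y\<in>carrier Loc. Y \<oplus>\<^bsub>Loc\<^esub> X = \<zero>\<^bsub>Loc\<^esub>"
      using s by (intro bexI[of _ "fr (\<ominus> s) m"]) (simp_all add: Loc_add_same l_neg fr_zero)
  qed
  show "monoid Loc"
  proof (rule monoidI)
    fix X Y assume XY: "X \<in> carrier Loc" "Y \<in> carrier Loc"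
    obtain s m where X: "s \<in> carrier R" "X = fr s m" using XY(1) by (rule Loc_cases)
    obtain t n where Y: "t \<in> carrier R" "Y = fr t n" using XY(2) by (rule Loc_cases)
    show "X \<otimes>\<^bsub>Loc\<^esub> Y \<in> carrier Loc" using X Y by (simp add: Loc_mult)
    fix Z assume "Z \<in> carrier Loc"
    then obtain u p where "u \<in> carrier R" "Z = fr u p" by (rule Loc_cases)
    with X Y show "X \<otimes>\<^bsub>Loc\<^esub> Y \<otimes>\<^bsub>Loc\<^esub> Z = X \<otimes>\<^bsub>Loc\<^esub> (Y \<otimes>\<^bsub>Loc\<^esub> Z)"
      by (simp add: Loc_mult m_assoc add_ac)
  next
    show "\<one>\<^bsub>Loc\<^esub> \<in> carrier Loc" by (simp add: Loc_one)
  next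
    fix X assume "X \<in> carrier Loc"
    then obtain s m where s: "s \<in> carrier R" "X = fr s m" by (rule Loc_cases)
    then show "\<one>\<^bsub>Loc\<^esub> \<otimes>\<^bsub>Loc\<^esub> X = X" "X \<otimes>\<^bsub>Loc\<^esub> \<one>\<^bsub>Loc\<^esub> = X"
      by (simp_all add: Loc_one Loc_mult)
  qed
  fix X Y Z assume XYZ: "X \<in> carrier Loc" "Y \<in> carrier Loc" "Z \<in> carrier Loc"
  obtain s t m where *: "s \<in> carrier R" "t \<in> carrier R" "X = fr s m" "Y = fr t m"
    using XYZ(1,2) by (rule Loc_common_denominator)
  obtain u p where "u \<in> carrier R" "Z = fr u p" using XYZ(3) by (rule Loc_cases)
  with * show "(X \<oplus>\<^bsub>Loc\<^esub> Y) \<otimes>\<^bsub>Loc\<^esub> Z = X \<otimes>\<^bsub>Loc\<^esub> Z \<oplus>\<^bsub>Loc\<^esub> Y \<otimes>\<^bsub>Loc\<^esub> Z"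
    "Z \<otimes>\<^bsub>Loc\<^esub> (X \<oplus>\<^bsub>Loc\<^esub> Y) = Z \<otimes>\<^bsub>Loc\<^esub> X \<oplus>\<^bsub>Loc\<^esub> Z \<otimes>\<^bsub>Loc\<^esub> Y"
    by (simp_all add: Loc_mult Loc_add_same l_distr r_distr)
qed

lemma Loc_minus:
  assumes "s \<in> carrier R"
  shows "\<ominus>\<^bsub>Loc\<^esub> fr s m = fr (\<ominus> s) m"
  using assms by (intro abelian_group.minus_equality[OF ring.is_abelian_group[OF ring_Loc]])
    (simp_all add: Loc_add_same l_neg fr_zero)

end

section \<open>Sums of homogeneous elements\<close>

context ring
begin

definition graded_sums :: "(nat \<Rightarrow> 'a set) \<Rightarrow> 'a set" where
  "graded_sums W = {\<Oplus>k\<in>{..N}. x k | x N. \<forall>k\<le>N. x k \<in> W k}"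

text \<open>
The induction principle for sums of homogeneous elements.
\<close>

lemma graded_sums_subset:
  assumes W: "\<And>k. W k \<subseteq> C" and "C \<subseteq> carrier R"
    and add: "\<And>x y. x \<in> C \<Longrightarrow> y \<in> C \<Longrightarrow> x \<oplus> y \<in> C"
  shows "graded_sums W \<subseteq> C"
proof -
  have "(\<Oplus>k\<in>{..N}. x k) \<in> C" if "\<forall>k\<le>N. x k \<in> W k" for x and N :: nat
    using that
  proof (induction N)
    case 0
    then have "x 0 \<in> C" using W by blast
    then show ?case using assms(2) by (auto simp: finsum_0)
  next
    case (Suc N)
    have "x \<in> {..Suc N} \<rightarrow> carrier R" using Suc.prems W assms(2) by fastforce
    then have "(\<Oplus>k\<in>{..Suc N}. x k) = x (Suc N) \<oplus> (\<Oplus>k\<in>{..N}. x k)"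
      by simp
    moreover have "x (Suc N) \<in> C" using Suc.prems W by blast
    ultimately show ?case using add Suc by simp
  qed
  then show ?thesis unfolding graded_sums_def by blast
qed

context
  fixes W :: "nat \<Rightarrow> 'a set"
  assumes W_carrier: "\<And>k. W k \<subseteq> carrier R"
    and W_zero: "\<And>k. \<zero> \<in> W k"
    and W_add: "\<And>k x y. x \<in> W k \<Longrightarrow> y \<in> W k \<Longrightarrow> x \<oplus> y \<in> W k"
begin

lemma graded_sums_extend:
  assumes "\<forall>k\<le>N. x k \<in> W k" "N \<le> N'"
  shows "(\<Oplus>k\<in>{..N}. x k) = (\<Oplus>k\<in>{..N'}. if k \<le> N then x k else \<zero>)"
proof -
  have [simp]: "x k \<in> carrier R" if "k \<le> N" for k
    using that assms(1) W_carrier by blast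
  have "(\<Oplus>k\<in>{..N'}. if k \<le> N then x k else \<zero>) = (\<Oplus>k\<in>{..N}. if k \<le> N then x k else \<zero>)"
    using assms(2) by (intro add.finprod_mono_neutral_cong_right) auto
  also have "\<dots> = (\<Oplus>k\<in>{..N}. x k)"
    by (intro finsum_cong') auto
  finally show ?thesis ..
qed

lemma graded_sums_homogeneous: "W k \<subseteq> graded_sums W"
proof
  fix y assume y: "y \<in> W k"
  have "(\<Oplus>l\<in>{..k}. if k = l then y else \<zero>) = y"
    using y W_carrier by (intro finsum_singleton) auto
  then have "y = (\<Oplus>l\<in>{..k}. if k = l then y else \<zero>)" by simp
  moreover have "\<forall>l\<le>k. (if k = l then y else \<zero>) \<in> W l" using y W_zero by simp
  ultimately show "y \<in> graded_sums W" unfolding graded_sums_def by blast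
qed

lemma graded_sums_add:
  assumes "a \<in> graded_sums W" "b \<in> graded_sums W"
  shows "a \<oplus> b \<in> graded_sums W"
proof -
  obtain x N y N' where x: "\<forall>k\<le>N. x k \<in> W k" "a = (\<Oplus>k\<in>{..N}. x k)"
    and y: "\<forall>k\<le>N'. y k \<in> W k" "b = (\<Oplus>k\<in>{..N'}. y k)"
    using assms unfolding graded_sums_def by blast
  define x' y' where "x' k = (if k \<le> N then x k else \<zero>)"
    and "y' k = (if k \<le> N' then y k else \<zero>)" for k
  have W': "x' k \<in> W k" "y' k \<in> W k" for k
    using x y W_zero by (simp_all add: x'_def y'_def)
  have "a = (\<Oplus>k\<in>{..N + N'}. x' k)"
    unfolding x(2) x'_def by (rule graded_sums_extend[OF x(1)]) simp
  moreover have "b = (\<Oplus>k\<in>{..N + N'}. y' k)"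
    unfolding y(2) y'_def by (rule graded_sums_extend[OF y(1)]) simp
  ultimately have "a \<oplus> b = (\<Oplus>k\<in>{..N + N'}. x' k \<oplus> y' k)"
    using W' W_carrier by (subst finsum_addf) auto
  moreover have "\<forall>k\<le>N + N'. x' k \<oplus> y' k \<in> W k" using W' W_add by blast
  ultimately show ?thesis unfolding graded_sums_def by blast
qed

lemma graded_sums_closed: "graded_sums W \<subseteq> carrier R"
  by (rule graded_sums_subset) (use W_carrier in auto)

text \<open>
Bilinearity reduces products to homogeneous factors, first in the right factor and then in the left
one.
\<close>

lemma subring_graded_sums:
  assumes W_minus: "\<And>k x. x \<in> W k \<Longrightarrow> \<ominus> x \<in> W k"
    and W_one: "\<one> \<in> W 0"
    and W_mult: "\<And>k l x y. x \<in> W k \<Longrightarrow> y \<in> W l \<Longrightarrow> x \<otimes> y \<in> W (k + l)"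
  shows "subring (graded_sums W) R"
proof (rule subringI)
  show "graded_sums W \<subseteq> carrier R" by (rule graded_sums_closed)
  show "\<one> \<in> graded_sums W" using graded_sums_homogeneous W_one by blast
  show "a \<oplus> b \<in> graded_sums W" if "a \<in> graded_sums W" "b \<in> graded_sums W" for a b
    using that by (rule graded_sums_add)
  have homog: "c \<in> graded_sums W" if "c \<in> W k" for c k
    using graded_sums_homogeneous that by blast
  have "graded_sums W \<subseteq> {a \<in> graded_sums W. \<ominus> a \<in> graded_sums W}"
    using graded_sums_closed W_minus
    by (intro graded_sums_subset) (auto intro: homog simp: minus_add graded_sums_add subset_iff)
  then show "\<ominus> a \<in> graded_sums W" if "a \<in> graded_sums W" for a
    using that by blast
  have "graded_sums W \<subseteq> {a \<in> graded_sums W. \<forall>k. \<forall>b\<in>W k. a \<otimes> b \<in> graded_sums W}"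
    using graded_sums_closed W_carrier
    by (intro graded_sums_subset) (auto intro: homog W_mult simp: l_distr graded_sums_add subset_iff)
  then have *: "a \<otimes> b \<in> graded_sums W" if "a \<in> graded_sums W" "b \<in> W k" for a b k
    using that by blast
  have "graded_sums W \<subseteq> {b \<in> graded_sums W. \<forall>a\<in>graded_sums W. a \<otimes> b \<in> graded_sums W}"
    using graded_sums_closed
    by (intro graded_sums_subset) (auto intro: homog * simp: r_distr graded_sums_add subset_iff)
  then show "a \<otimes> b \<in> graded_sums W" if "a \<in> graded_sums W" "b \<in> graded_sums W" for a b
    using that by blast
qed

end
end

text \<open>
Negation in a ring with restricted carrier is described by a search in that carrier, so that
generation inside a subring is not literally generation inside the ring.
\<close>

lemma (in ring) generate_ring_subring_eq:
  assumes "subring A R" "X \<subseteq> A"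
  shows "generate_ring (R\<lparr>carrier := A\<rparr>) X = generate_ring R X"
proof -
  have "X \<subseteq> carrier R" using assms subringE(1) by blast
  moreover have "R\<lparr>carrier := carrier R\<rparr> = R" by simp
  ultimately show ?thesis
    using subring_gen_incl[OF assms(1) carrier_is_subring assms(2)]
      subring_gen_incl[OF carrier_is_subring assms(1) _ assms(2)]
    by (simp add: antisym)
qed

section \<open>Linear independence of weights\<close>

text \<open>
Linear independence of simultaneous eigenvectors with different eigenvalues, modulo a stable
subspace \<open>I\<close>. A summand of weight other than \<open>\<mu>\<close> is removed with an operator \<open>f h\<close> that
separates this weight from \<open>\<mu>\<close>; the other summands change by scalars only, and those of weight
\<open>\<mu>\<close> stay.
\<close>

lemma (in vector_space) other_weights_vanish:
  fixes f :: "'h \<Rightarrow> 'b \<Rightarrow> 'b" and v :: "'t \<Rightarrow> 'b" and wt :: "'t \<Rightarrow> 'h \<Rightarrow> 'a" and \<mu> :: "'h \<Rightarrow> 'a"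
  assumes f_add: "\<And>h x y. f h (x + y) = f h x + f h y"
    and f_scale: "\<And>h c x. f h (scale c x) = scale c (f h x)"
    and I: "subspace I" and f_I: "\<And>h x. x \<in> I \<Longrightarrow> f h x \<in> I"
    and "finite T"
    and wt: "\<And>t h. t \<in> T \<Longrightarrow> f h (v t) - scale (wt t h) (v t) \<in> I"
    and \<mu>: "\<And>h. f h (\<Sum>t\<in>T. v t) - scale (\<mu> h) (\<Sum>t\<in>T. v t) \<in> I"
  shows "(\<Sum>t | t \<in> T \<and> wt t \<noteq> \<mu>. v t) \<in> I"
  using \<open>finite T\<close> wt \<mu>
proof (induction "card {t \<in> T. wt t \<noteq> \<mu>}" arbitrary: T v)
  case 0
  then have "{t \<in> T. wt t \<noteq> \<mu>} = {}" by (subst (asm) eq_commute) simp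
  then show ?case using subspace_0[OF I] by (simp only: sum.empty)
next
  case (Suc n)
  have f_0: "f h 0 = 0" for h using f_add[of h 0 0] by simp
  have f_sum: "f h (sum g A) = (\<Sum>t\<in>A. f h (g t))" for h and g :: "'t \<Rightarrow> 'b" and A
    by (induction A rule: infinite_finite_induct) (simp_all add: f_0 f_add)
  have "{t \<in> T. wt t \<noteq> \<mu>} \<noteq> {}" using Suc.hyps(2) by (metis card.empty nat.distinct(1))
  then obtain s where s: "s \<in> T" "wt s \<noteq> \<mu>" by blast
  then obtain h0 where h0: "wt s h0 \<noteq> \<mu> h0" by blast
  define d where "d = wt s h0 - \<mu> h0"
  have d: "d \<noteq> 0" using h0 by (simp add: d_def)
  \<comment> \<open>Modulo \<open>I\<close> this applies \<open>id - (f h0 - \<mu> h0) / d\<close>, which annihilates the summand \<open>s\<close> and fixes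
    the summands of weight \<open>\<mu>\<close>.\<close>
  define v' where "v' t = scale (1 - (wt t h0 - \<mu> h0) / d) (v t)" for t
  have v's: "v' s = 0" using d by (simp add: v'_def d_def)
  let ?x = "\<Sum>t\<in>T. v t" and ?y = "\<Sum>t\<in>T - {s}. v' t"
  have y: "?y = (\<Sum>t\<in>T. v' t)" 
    using Suc.prems(1) s(1) v's by (simp add: sum.remove)
  have "?x - ?y = (\<Sum>t\<in>T. scale (1 / d) (scale (wt t h0 - \<mu> h0) (v t)))"
    unfolding y sum_subtractf[symmetric]
    unfolding v'_def scale_left_diff_distrib[of 1] scale_scale by simp
  also have "\<dots> = scale (1 / d) (\<Sum>t\<in>T. scale (wt t h0 - \<mu> h0) (v t))"
    by (simp only: scale_sum_right)
  also have "(\<Sum>t\<in>T. scale (wt t h0 - \<mu> h0) (v t))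
      = (f h0 ?x - scale (\<mu> h0) ?x) - (\<Sum>t\<in>T. f h0 (v t) - scale (wt t h0) (v t))"
    by (simp add: f_sum scale_left_diff_distrib sum_subtractf scale_sum_right)
  also have "scale (1 / d) \<dots> \<in> I"
    by (intro subspace_scale[OF I] subspace_diff[OF I] subspace_sum[OF I] Suc.prems)
  finally have xy: "?x - ?y \<in> I" .
  have eqv: "f h ?y - scale (\<mu> h) ?y \<in> I" for h
  proof -
    have "f h ?x = f h (?x - ?y) + f h ?y" unfolding f_add[symmetric] by simp
    then have "f h ?y - scale (\<mu> h) ?y
        = (f h ?x - scale (\<mu> h) ?x) - (f h (?x - ?y) - scale (\<mu> h) (?x - ?y))"
      by (simp add: scale_right_diff_distrib)
    then show ?thesis
      using subspace_diff[OF I Suc.prems(3) subspace_diff[OF I f_I[OF xy] subspace_scale[OF I xy]]]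
      by simp
  qed
  have "card {t \<in> T - {s}. wt t \<noteq> \<mu>} = n"
  proof -
    have "{t \<in> T - {s}. wt t \<noteq> \<mu>} = {t \<in> T. wt t \<noteq> \<mu>} - {s}" by blast
    then show ?thesis using Suc.hyps(2) s Suc.prems(1) by simp
  qed
  moreover have "f h (v' t) - scale (wt t h) (v' t) \<in> I" if "t \<in> T - {s}" for t h
  proof -
    have "f h (v' t) - scale (wt t h) (v' t)
        = scale (1 - (wt t h0 - \<mu> h0) / d) (f h (v t) - scale (wt t h) (v t))"
      by (simp add: v'_def f_scale scale_right_diff_distrib mult.commute)
    then show ?thesis using that Suc.prems(2) subspace_scale[OF I] by simp
  qed
  ultimately have IH: "(\<Sum>t | t \<in> T - {s} \<and> wt t \<noteq> \<mu>. v' t) \<in> I"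
    using Suc.hyps(1)[of "T - {s}" v'] Suc.prems(1) eqv by simp
  have split: "sum g T = (\<Sum>t | t \<in> T \<and> wt t \<noteq> \<mu>. g t) + (\<Sum>t | t \<in> T \<and> wt t = \<mu>. g t)" for g :: "'t \<Rightarrow> 'b"
    using Suc.prems(1) by (subst sum.union_disjoint[symmetric]) (auto intro!: sum.cong)
  have "(\<Sum>t | t \<in> T - {s} \<and> wt t \<noteq> \<mu>. v' t) = (\<Sum>t | t \<in> T \<and> wt t \<noteq> \<mu>. v' t)"
    using Suc.prems(1) v's by (intro sum.mono_neutral_left) auto
  moreover have "(\<Sum>t | t \<in> T \<and> wt t = \<mu>. v' t) = (\<Sum>t | t \<in> T \<and> wt t = \<mu>. v t)"
    by (intro sum.cong refl) (auto simp: v'_def)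
  ultimately have "(\<Sum>t | t \<in> T \<and> wt t \<noteq> \<mu>. v t) = (?x - ?y) + (\<Sum>t | t \<in> T - {s} \<and> wt t \<noteq> \<mu>. v' t)"
    unfolding y using split[of v] split[of v'] by simp
  then show ?case using subspace_add[OF I xy IH] by simp
qed


section \<open>The free algebra and the action of the Cartan subalgebra\<close>

lemma poly_mapping_eq_sum_single:
  "(a :: 'w \<Rightarrow>\<^sub>0 'k::comm_monoid_add) = (\<Sum>w\<in>Poly_Mapping.keys a. Poly_Mapping.single w (Poly_Mapping.lookup a w))"
proof (rule poly_mapping_eqI)
  fix k
  show "Poly_Mapping.lookup a k =
      Poly_Mapping.lookup (\<Sum>w\<in>Poly_Mapping.keys a. Poly_Mapping.single w (Poly_Mapping.lookup a w)) k"
    by (cases "k \<in> Poly_Mapping.keys a")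
      (auto simp: lookup_sum lookup_single when_def sum.delta in_keys_iff)
qed

lemma poly_mapping_keys_induct:
  fixes a :: "'w \<Rightarrow>\<^sub>0 'k::comm_monoid_add"
  assumes "\<And>w. w \<in> Poly_Mapping.keys a \<Longrightarrow> P (Poly_Mapping.single w (Poly_Mapping.lookup a w))"
    and "P 0" and "\<And>x y. P x \<Longrightarrow> P y \<Longrightarrow> P (x + y)"
  shows "P a"
proof -
  have "P (\<Sum>w\<in>A. Poly_Mapping.single w (Poly_Mapping.lookup a w))"
    if "finite A" "A \<subseteq> Poly_Mapping.keys a" for A
    using that by (induction A rule: finite_induct) (auto intro: assms)
  from this[of "Poly_Mapping.keys a"] show ?thesis
    by (simp add: poly_mapping_eq_sum_single[symmetric])
qed

lemma poly_mapping_single_induct: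
  fixes a :: "'w \<Rightarrow>\<^sub>0 'k::comm_monoid_add"
  assumes "\<And>w c. P (Poly_Mapping.single w c)" and "\<And>x y. P x \<Longrightarrow> P y \<Longrightarrow> P (x + y)"
  shows "P a"
  by (rule poly_mapping_keys_induct) (use assms assms(1)[of undefined 0] in auto)

abbreviation word_single :: "'x list \<Rightarrow> 'k \<Rightarrow> ('x word \<Rightarrow>\<^sub>0 'k::comm_ring_1)" where
  "word_single w c \<equiv> Poly_Mapping.single (Word w) c"

lemma word_single_mult: "word_single u c * word_single v d = word_single (u @ v) (c * d)"
  by (simp add: mult_single plus_word_def)

lemma word_single_Nil: "word_single [] c = const c"
  by (simp add: zero_word_def)

lemma const_mult_word_single: "const c * word_single w d = word_single w (c * d)"
  by (simp add: mult_single)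

lemma const_commute: "const c * a = a * const (c :: 'k::comm_ring_1)"
  by (induction a rule: poly_mapping_single_induct)
    (simp_all add: mult_single mult.commute distrib_left distrib_right)

lemma const_scale: "const c * (const d * a) = const (c * d) * (a :: 'x word \<Rightarrow>\<^sub>0 'k::comm_ring_1)"
  by (simp add: mult.assoc[symmetric] mult_single)

lemma vector_space_free_alg: "vector_space (\<lambda>(c :: 'k::field) (a :: 'x word \<Rightarrow>\<^sub>0 'k). const c * a)"
  by standard (simp_all add: distrib_left distrib_right single_add const_scale)

lemma sum_lessThan_add: "sum f {..<m + n} = sum f {..<m} + (\<Sum>l<n. f (m + l))"
  for m n :: nat and f :: "nat \<Rightarrow> 'a::comm_monoid_add"
  by (induction n) (simp_all add: add.assoc)

lemma h_act_add: "h_act G h (a + b) = h_act G h a + h_act G h b"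
  unfolding h_act_def
  by (rule setsum_keys_plus_distrib) (simp_all add: single_add sum.distrib)

lemma h_act_single:
  "h_act G h (word_single w c) = (\<Sum>l<length w. word_single (w[l := brk G (emb G h) (w ! l)]) c)"
  by (cases "c = 0") (simp_all add: h_act_def)

lemma h_act_0: "h_act G h 0 = 0"
  by (simp add: h_act_def)

lemma h_act_minus: "h_act G h (- a) = - h_act G h a"
proof -
  have "h_act G h a + h_act G h (- a) = 0" unfolding h_act_add[symmetric] by (simp add: h_act_0)
  then show ?thesis by (simp add: add_eq_0_iff)
qed

lemma h_act_diff: "h_act G h (a - b) = h_act G h a - h_act G h b"
  unfolding diff_conv_add_uminus by (simp only: h_act_add h_act_minus)

lemma h_act_letter: "h_act G h (letter x) = letter (brk G (emb G h) x)"
  by (simp add: h_act_single)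

lemma h_act_const: "h_act G h (const c) = 0"
  by (simp add: word_single_Nil[symmetric] h_act_single)

text \<open>
The substitution of one letter in a concatenation takes place in one of the two words.
\<close>

lemma h_act_mult: "h_act G h (a * b) = h_act G h a * b + a * h_act G h b"
proof (induction a rule: poly_mapping_single_induct)
  case (1 w c)
  obtain u where w: "w = Word u" by (cases w)
  show ?case
  proof (induction b rule: poly_mapping_single_induct)
    case (1 w' d)
    obtain v where w': "w' = Word v" by (cases w')
    have "h_act G h (word_single (u @ v) (c * d)) =
        (\<Sum>l<length u. word_single (u[l := brk G (emb G h) (u ! l)] @ v) (c * d)) +
        (\<Sum>l<length v. word_single (u @ v[l := brk G (emb G h) (v ! l)]) (c * d))"
      by (simp add: h_act_single sum_lessThan_add nth_append list_update_append)
    also have "\<dots> = h_act G h (word_single u c) * word_single v d + word_single u c * h_act G h (word_single v d)"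
      by (simp add: h_act_single sum_distrib_left sum_distrib_right word_single_mult)
    finally show ?case by (simp add: w w' word_single_mult)
  qed (simp add: h_act_add distrib_left algebra_simps)
qed (simp add: h_act_add distrib_right algebra_simps)

lemma h_act_scale: "h_act G h (const c * a) = const c * h_act G h a"
  by (simp add: h_act_mult h_act_const)

lemma free_alg_simps:
  "mult (free_alg V) = (*)" "one (free_alg V) = 1" "zero (free_alg V) = 0" "add (free_alg V) = (+)"
  by (simp_all add: free_alg_def)

lemma mem_free_alg: "a \<in> carrier (free_alg V) \<longleftrightarrow> (\<forall>w\<in>Poly_Mapping.keys a. set (letters w) \<subseteq> V)"
  by (simp add: free_alg_def)

lemma free_alg_zero [simp]: "0 \<in> carrier (free_alg V)"
  by (simp add: mem_free_alg)

lemma free_alg_word_single [simp]: "set w \<subseteq> V \<Longrightarrow> word_single w c \<in> carrier (free_alg V)"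
  by (simp add: mem_free_alg)

lemma free_alg_const [simp]: "const c \<in> carrier (free_alg V)"
  unfolding word_single_Nil[symmetric] by (rule free_alg_word_single) simp

lemma free_alg_one [simp]: "1 \<in> carrier (free_alg V)"
  using free_alg_const[of 1] by simp

lemma free_alg_add [simp]:
  "a \<in> carrier (free_alg V) \<Longrightarrow> b \<in> carrier (free_alg V) \<Longrightarrow> a + b \<in> carrier (free_alg V)"
  unfolding mem_free_alg using Poly_Mapping.keys_add[of a b] by blast

lemma free_alg_uminus [simp]:
  "a \<in> carrier (free_alg V) \<Longrightarrow> - a \<in> carrier (free_alg V)"
  by (simp add: mem_free_alg in_keys_iff)

lemma free_alg_diff [simp]:
  "a \<in> carrier (free_alg V) \<Longrightarrow> b \<in> carrier (free_alg V) \<Longrightarrow> a - b \<in> carrier (free_alg V)"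
  using free_alg_add[of a V "- b"] by simp

lemma free_alg_mult [simp]:
  assumes "a \<in> carrier (free_alg V)" "b \<in> carrier (free_alg V)"
  shows "a * b \<in> carrier (free_alg V)"
  unfolding mem_free_alg
proof
  fix w assume "w \<in> Poly_Mapping.keys (a * b)"
  then obtain u v where "w = u + v" "u \<in> Poly_Mapping.keys a" "v \<in> Poly_Mapping.keys b"
    using keys_mult[of a b] by blast
  then show "set (letters w) \<subseteq> V" using assms unfolding mem_free_alg
    by (auto simp: plus_word_def)
qed

lemma free_alg_sum [simp]:
  "(\<And>t. t \<in> T \<Longrightarrow> f t \<in> carrier (free_alg V)) \<Longrightarrow> sum f T \<in> carrier (free_alg V)"
  by (induction T rule: infinite_finite_induct) simp_all

lemma ring_free_alg: "ring (free_alg V)"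
proof (rule ringI)
  show "abelian_group (free_alg V)"
  proof (rule abelian_groupI)
    show "\<exists>b\<in>carrier (free_alg V). b \<oplus>\<^bsub>free_alg V\<^esub> a = \<zero>\<^bsub>free_alg V\<^esub>" if "a \<in> carrier (free_alg V)" for a
      using that by (intro bexI[of _ "- a"]) (simp_all add: free_alg_simps)
  qed (simp_all add: free_alg_simps add_ac)
  show "monoid (free_alg V)"
    by (rule monoidI) (simp_all add: free_alg_simps mult.assoc)
qed (simp_all add: free_alg_simps distrib_left distrib_right)

lemma free_alg_a_inv: "a \<in> carrier (free_alg V) \<Longrightarrow> \<ominus>\<^bsub>free_alg V\<^esub> a = - a"
  by (rule abelian_group.minus_equality[OF ring.is_abelian_group[OF ring_free_alg]])
    (simp_all add: free_alg_simps)

lemma free_alg_a_minus: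
  "a \<in> carrier (free_alg V) \<Longrightarrow> b \<in> carrier (free_alg V) \<Longrightarrow> a \<ominus>\<^bsub>free_alg V\<^esub> b = a - b"
  by (simp add: a_minus_def free_alg_a_inv) (simp add: free_alg_simps)

lemma h_act_free_alg:
  assumes V: "\<And>x. x \<in> V \<Longrightarrow> brk G (emb G h) x \<in> V" and a: "a \<in> carrier (free_alg V)"
  shows "h_act G h a \<in> carrier (free_alg V)"
proof (induction a rule: poly_mapping_keys_induct)
  case (1 w)
  obtain u where w: "w = Word u" by (cases w)
  have "set u \<subseteq> V" using 1 a unfolding w mem_free_alg by fastforce
  then have "set (u[l := brk G (emb G h) (u ! l)]) \<subseteq> V" if "l < length u" for l
    using that V by (intro subset_trans[OF set_update_subset_insert]) (auto simp: subset_iff)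
  then show ?case unfolding w h_act_single by (intro free_alg_sum free_alg_word_single) simp
qed (simp_all add: h_act_0 h_act_add)

context
  fixes V :: "'x set" and J :: "('x word \<Rightarrow>\<^sub>0 'k::comm_ring_1) set"
  assumes J: "ideal J (free_alg V)"
begin

lemma free_alg_ideal_subset: "J \<subseteq> carrier (free_alg V)"
  using ideal.Icarr[OF J] by blast

lemma free_alg_ideal_zero: "0 \<in> J"
  using additive_subgroup.zero_closed[OF ideal.axioms(1)[OF J]] by (simp add: free_alg_simps)

lemma free_alg_ideal_add: "a \<in> J \<Longrightarrow> b \<in> J \<Longrightarrow> a + b \<in> J"
  using additive_subgroup.a_closed[OF ideal.axioms(1)[OF J], of a b] by (simp add: free_alg_simps)

lemma free_alg_ideal_mult_left: "a \<in> J \<Longrightarrow> x \<in> carrier (free_alg V) \<Longrightarrow> x * a \<in> J"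
  using ideal.I_l_closed[OF J, of a x] by (simp add: free_alg_simps)

lemma free_alg_ideal_mult_right: "a \<in> J \<Longrightarrow> x \<in> carrier (free_alg V) \<Longrightarrow> a * x \<in> J"
  using ideal.I_r_closed[OF J, of a x] by (simp add: free_alg_simps)

lemma free_alg_ideal_uminus: "a \<in> J \<Longrightarrow> - a \<in> J"
  using free_alg_ideal_mult_left[of a "- 1"] by simp

lemma free_alg_ideal_diff: "a \<in> J \<Longrightarrow> b \<in> J \<Longrightarrow> a - b \<in> J"
  using free_alg_ideal_add[of a "- b"] free_alg_ideal_uminus[of b] by simp

end

lemma ideal_free_algI:
  fixes J :: "('x word \<Rightarrow>\<^sub>0 'k::comm_ring_1) set"
  assumes J: "J \<subseteq> carrier (free_alg V)" "0 \<in> J" and add: "\<And>a b. a \<in> J \<Longrightarrow> b \<in> J \<Longrightarrow> a + b \<in> J"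
    and mult: "\<And>a x. a \<in> J \<Longrightarrow> x \<in> carrier (free_alg V) \<Longrightarrow> x * a \<in> J"
      "\<And>a x. a \<in> J \<Longrightarrow> x \<in> carrier (free_alg V) \<Longrightarrow> a * x \<in> J"
  shows "ideal J (free_alg V)"
proof (rule idealI)
  interpret F: ring "free_alg V" by (rule ring_free_alg)
  show "subgroup J (add_monoid (free_alg V))"
  proof (rule F.add.subgroupI)
    show "\<ominus>\<^bsub>free_alg V\<^esub> a \<in> J" if "a \<in> J" for a
    proof -
      have "a \<in> carrier (free_alg V)" using J(1) that by blast
      then show ?thesis using mult(1)[OF that, of "- 1"] by (simp add: free_alg_a_inv)
    qed
  qed (use J add in \<open>auto simp: free_alg_simps\<close>)
qed (use mult in \<open>simp_all add: ring_free_alg free_alg_simps\<close>)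


section \<open>The supersymmetric algebra on homogeneous generators\<close>

text \<open>
The root of the letter \<open>b\<close> is \<open>wt b\<close>, so that \<open>b\<close> has weight \<open>- wt b\<close>.
\<close>

locale homogeneous_generators =
  fixes G :: "('k::field_char_0, 'g::ab_group_add, 'h, 'i::finite) superdata"
    and B :: "'g set" and pr :: "'g \<Rightarrow> bit" and wt :: "'g \<Rightarrow> 'h \<Rightarrow> 'k"
  assumes lie: "lie_superalgebra G" and emb_even: "range (emb G) \<subseteq> grade G 0"
    and finite_B: "finite B" and span_B: "nminus G = Modules.module.span (scl G) B"
    and pr: "b \<in> B \<Longrightarrow> b \<in> grade G (pr b)"
    and wt: "b \<in> B \<Longrightarrow> brk G (emb G h) b = scl G (- wt b h) b"
begin

sublocale g: vector_space "scl G"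
  using lie by (simp add: lie_superalgebra_def)

abbreviation "V \<equiv> nminus G"
abbreviation "FA \<equiv> free_alg V"
abbreviation "I \<equiv> sym_ideal G V"
abbreviation "S \<equiv> sym_alg G V"
abbreviation "\<pi> \<equiv> sym_elem G"

lemma brk_add: "brk G x (y + z) = brk G x y + brk G x z"
  using lie by (simp add: lie_superalgebra_def Vector_Spaces.linear_iff)

lemma brk_scl: "brk G x (scl G c y) = scl G c (brk G x y)"
  using lie by (simp add: lie_superalgebra_def Vector_Spaces.linear_iff)

lemma subspace_V: "g.subspace V"
  by (simp add: span_B)

lemma B_V: "b \<in> B \<Longrightarrow> b \<in> V"
  by (simp add: span_B g.span_base)

lemma brk_emb_V:
  assumes "x \<in> V"
  shows "brk G (emb G h) x \<in> V"
proof -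
  have "g.subspace {x \<in> V. brk G (emb G h) x \<in> V}"
  proof -
    have "brk G (emb G h) 0 = 0" using brk_scl[of _ 0 0] by simp
    then show ?thesis
      using subspace_V unfolding g.subspace_def by (auto simp: brk_add brk_scl)
  qed
  moreover have "B \<subseteq> {x \<in> V. brk G (emb G h) x \<in> V}"
    using g.subspace_scale[OF subspace_V] g.subspace_neg[OF subspace_V] by (auto simp: B_V wt)
  ultimately show ?thesis
    using assms g.span_minimal unfolding span_B by blast
qed

lemma brk_emb_grade:
  assumes "x \<in> grade G p"
  shows "brk G (emb G h) x \<in> grade G p"
proof -
  have "emb G h \<in> grade G 0" using emb_even by blast
  then have "brk G (emb G h) x \<in> grade G (0 + p)"
    using lie assms unfolding lie_superalgebra_def by blast
  then show ?thesis by (simp only: add_0_left)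
qed

definition supercommutator :: "bit \<Rightarrow> bit \<Rightarrow> 'g \<Rightarrow> 'g \<Rightarrow> ('g word \<Rightarrow>\<^sub>0 'k)" where
  "supercommutator p q x y = letter x * letter y - const (koszul p q) * letter y * letter x"

definition sym_rels :: "('g word \<Rightarrow>\<^sub>0 'k) set" where
  "sym_rels = linear_rels G V \<union>
     {supercommutator p q x y | x y p q. x \<in> V \<inter> grade G p \<and> y \<in> V \<inter> grade G q}"

lemma sym_ideal_eq: "I = Idl\<^bsub>FA\<^esub> sym_rels"
  unfolding sym_ideal_def sym_rels_def supercommutator_def by simp

lemma sym_rels_FA: "sym_rels \<subseteq> carrier FA"
  using subspace_V
  by (auto simp: sym_rels_def linear_rels_def supercommutator_def g.subspace_add g.subspace_scale
      intro!: free_alg_diff free_alg_mult)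

lemma ideal_I: "ideal I FA"
  unfolding sym_ideal_eq by (rule ring.genideal_ideal[OF ring_free_alg sym_rels_FA])

lemmas I_FA = subsetD[OF free_alg_ideal_subset[OF ideal_I]]
lemmas I_zero [simp] = free_alg_ideal_zero[OF ideal_I]
lemmas I_add = free_alg_ideal_add[OF ideal_I]
lemmas I_diff = free_alg_ideal_diff[OF ideal_I]
lemmas I_uminus = free_alg_ideal_uminus[OF ideal_I]
lemmas I_mult_left = free_alg_ideal_mult_left[OF ideal_I]
lemmas I_mult_right = free_alg_ideal_mult_right[OF ideal_I]

lemma I_minus_iff: "a - b \<in> I \<longleftrightarrow> b - a \<in> I"
  using I_uminus[of "a - b"] I_uminus[of "b - a"] by auto

lemma I_trans: "a - b \<in> I \<Longrightarrow> b - c \<in> I \<Longrightarrow> a - c \<in> I"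
  using I_add[of "a - b" "b - c"] by simp

lemma I_cong_add: "a - a' \<in> I \<Longrightarrow> b - b' \<in> I \<Longrightarrow> (a + b) - (a' + b') \<in> I"
  using I_add[of "a - a'" "b - b'"] by (simp add: algebra_simps)

lemma I_cong_mult:
  assumes "a - a' \<in> I" "b - b' \<in> I" "a \<in> carrier FA" "b' \<in> carrier FA"
  shows "a * b - a' * b' \<in> I"
proof -
  have "a * b - a' * b' = a * (b - b') + (a - a') * b'" by (simp add: algebra_simps)
  then show ?thesis using assms by (simp add: I_add I_mult_left I_mult_right)
qed

lemma sym_rels_I: "r \<in> sym_rels \<Longrightarrow> r \<in> I"
  using ring.genideal_self[OF ring_free_alg sym_rels_FA] unfolding sym_ideal_eq by blast

lemma letter_add: "x \<in> V \<Longrightarrow> y \<in> V \<Longrightarrow> letter (x + y) - (letter x + letter y) \<in> I"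
  by (rule sym_rels_I) (force simp: sym_rels_def linear_rels_def algebra_simps)

lemma letter_scl: "x \<in> V \<Longrightarrow> letter (scl G c x) - const c * letter x \<in> I"
  by (rule sym_rels_I) (auto simp: sym_rels_def linear_rels_def)

lemma letter_commute:
  "x \<in> V \<Longrightarrow> x \<in> grade G p \<Longrightarrow> y \<in> V \<Longrightarrow> y \<in> grade G q \<Longrightarrow> supercommutator p q x y \<in> I"
  by (rule sym_rels_I) (auto simp: sym_rels_def)

lemma h_act_supercommutator:
  "h_act G h (supercommutator p q x y)
     = supercommutator p q (brk G (emb G h) x) y + supercommutator p q x (brk G (emb G h) y)"
  by (simp add: supercommutator_def h_act_diff h_act_mult h_act_letter h_act_const algebra_simps)

lemma h_act_FA: "a \<in> carrier FA \<Longrightarrow> h_act G h a \<in> carrier FA"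
  by (rule h_act_free_alg) (rule brk_emb_V)

text \<open>
A derivation that maps the relations into the ideal preserves the ideal. The relations are mapped to
sums of relations of the same kind because elements of the Cartan subalgebra are even and preserve
\<open>n\<^sup>-\<close>. This makes the weight of an element of the quotient independent of the representative.
\<close>

lemma h_act_I:
  assumes "a \<in> I"
  shows "h_act G h a \<in> I"
proof -
  let ?J = "{a \<in> I. h_act G h a \<in> I}"
  have "ideal ?J FA"
    by (rule ideal_free_algI)
      (auto simp: I_FA h_act_0 h_act_add h_act_mult h_act_FA I_add I_mult_left I_mult_right)
  moreover have "sym_rels \<subseteq> ?J"
  proof
    fix r assume r: "r \<in> sym_rels"
    then consider
        (add) x y where "x \<in> V" "y \<in> V" "r = letter (x + y) - letter x - letter y"
      | (scl) c x where "x \<in> V" "r = letter (scl G c x) - const c * letter x"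
      | (comm) p q x y where "x \<in> V" "x \<in> grade G p" "y \<in> V" "y \<in> grade G q" "r = supercommutator p q x y"
      unfolding sym_rels_def linear_rels_def by blast
    then have "h_act G h r \<in> I"
    proof cases
      case add
      show ?thesis
        unfolding add(3) h_act_diff h_act_letter brk_add unfolding diff_diff_eq
        by (rule letter_add) (use add brk_emb_V in blast)+
    next
      case scl
      then show ?thesis using letter_scl[of "brk G (emb G h) x" c]
        by (simp add: h_act_diff h_act_letter h_act_scale brk_scl brk_emb_V)
    next
      case comm
      then show ?thesis
        by (simp add: h_act_supercommutator I_add letter_commute brk_emb_V brk_emb_grade)
    qed
    then show "r \<in> ?J" using sym_rels_I[OF r] by simp
  qed
  ultimately have "I \<subseteq> ?J"
    unfolding sym_ideal_eq[symmetric] using ring.genideal_minimal[OF ring_free_alg, of ?J V sym_rels]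
    by (simp add: sym_ideal_eq)
  then show ?thesis using assms by blast
qed

lemma letter_spanned:
  assumes "x \<in> V"
  shows "\<exists>a\<in>carrier (free_alg B). letter x - a \<in> I"
proof -
  have "x \<in> g.span B" using assms by (simp add: span_B)
  then have "x \<in> V \<and> (\<exists>a\<in>carrier (free_alg B). letter x - a \<in> I)"
  proof (induction rule: g.span_induct_alt)
    case base
    have "letter 0 \<in> I"
      using letter_scl[of 0 0] g.subspace_0[OF subspace_V] by simp
    then show ?case using g.subspace_0[OF subspace_V] by (auto intro!: bexI[of _ 0])
  next
    case (step c b y)
    then obtain a where a: "a \<in> carrier (free_alg B)" "letter y - a \<in> I" and y: "y \<in> V" by blast
    have b: "b \<in> V" "scl G c b \<in> V" using step B_V g.subspace_scale[OF subspace_V] by auto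
    have "letter (scl G c b + y) - (const c * letter b + a) \<in> I"
      by (rule I_trans[OF letter_add I_cong_add]) (use a y b letter_scl in auto)
    moreover have "const c * letter b + a \<in> carrier (free_alg B)"
      using a step by (intro free_alg_add free_alg_mult) auto
    ultimately show ?case using y b g.subspace_add[OF subspace_V] by blast
  qed
  then show ?thesis by blast
qed

text \<open>
Modulo the linear relations every letter is a combination of letters in \<open>B\<close>, and the products of
these combinations expand into words in \<open>B\<close>.
\<close>

lemma FA_spanned:
  assumes "a \<in> carrier FA"
  shows "\<exists>a'\<in>carrier (free_alg B). a - a' \<in> I"
proof (induction a rule: poly_mapping_keys_induct)
  case (1 w)
  let ?c = "Poly_Mapping.lookup a w"
  obtain u where w: "w = Word u" by (cases w)
  have "set u \<subseteq> V" using 1 assms unfolding w mem_free_alg by fastforce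
  then have "\<exists>a'\<in>carrier (free_alg B). word_single u ?c - a' \<in> I"
  proof (induction u)
    case Nil
    show ?case by (rule bexI[of _ "word_single [] ?c"]) simp_all
  next
    case (Cons x u)
    then obtain a' where a': "a' \<in> carrier (free_alg B)" "word_single u ?c - a' \<in> I" by auto
    obtain a'' where a'': "a'' \<in> carrier (free_alg B)" "letter x - a'' \<in> I"
      using letter_spanned[of x] Cons.prems by auto
    have "a' \<in> carrier FA" using a'(1) B_V unfolding mem_free_alg by blast
    then have "letter x * word_single u ?c - a'' * a' \<in> I"
      using a' a'' Cons.prems by (intro I_cong_mult) auto
    moreover have "letter x * word_single u ?c = word_single (x # u) ?c"
      by (simp add: word_single_mult)
    ultimately show ?case using a' a'' by (intro bexI[of _ "a'' * a'"]) auto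
  qed
  then show ?case by (simp add: w)
next
  case 2
  show ?case by (rule bexI[of _ 0]) simp_all
next
  case (3 x y)
  then show ?case by (meson I_cong_add free_alg_add)
qed

definition wsum :: "'g list \<Rightarrow> 'h \<Rightarrow> 'k" where
  "wsum w h = (\<Sum>b\<leftarrow>w. wt b h)"

lemma h_act_word:
  "set w \<subseteq> B \<Longrightarrow> h_act G h (word_single w c) - const (- wsum w h) * word_single w c \<in> I"
proof (induction w)
  case Nil
  show ?case by (simp add: h_act_single wsum_def)
next
  case (Cons b w)
  have eq: "word_single (b # w) c = letter b * word_single w c" by (simp add: word_single_mult)
  have b: "b \<in> V" "set w \<subseteq> V" using Cons.prems B_V by auto
  have "h_act G h (letter b) - const (- wt b h) * letter b \<in> I"
    using Cons.prems letter_scl[OF b(1), of "- wt b h"] by (simp add: h_act_letter wt)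
  then have "(h_act G h (letter b) - const (- wt b h) * letter b) * word_single w c
      + letter b * (h_act G h (word_single w c) - const (- wsum w h) * word_single w c) \<in> I"
    using b Cons by (intro I_add I_mult_left I_mult_right) auto
  also have "(h_act G h (letter b) - const (- wt b h) * letter b) * word_single w c
      + letter b * (h_act G h (word_single w c) - const (- wsum w h) * word_single w c)
      = h_act G h (word_single (b # w) c) - const (- wsum (b # w) h) * word_single (b # w) c"
  proof -
    have h1: "letter b * (const (- wsum w h) * word_single w c)
        = const (- wsum w h) * (letter b * word_single w c)"
      by (metis const_commute mult.assoc)
    have h2: "const (- wsum (b # w) h) = const (- wt b h) + const (- wsum w h)"
      by (simp add: wsum_def single_add[symmetric])
    show ?thesis
      unfolding eq h_act_mult h2 left_diff_distrib right_diff_distrib distrib_left distrib_right mult.assoc h1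
      by simp
  qed
  finally show ?case .
qed


lemma ring_S: "ring S"
  unfolding sym_alg_def by (rule ideal.quotient_is_ring[OF ideal_I])

lemma \<pi>_hom: "\<pi> \<in> ring_hom FA S"
  using ideal.rcos_ring_hom[OF ideal_I] unfolding sym_alg_def sym_elem_def by simp

lemma \<pi>_closed [simp]: "a \<in> carrier FA \<Longrightarrow> \<pi> a \<in> carrier S"
  using ring_hom_closed[OF \<pi>_hom] .

lemma \<pi>_mult: "a \<in> carrier FA \<Longrightarrow> b \<in> carrier FA \<Longrightarrow> \<pi> (a * b) = \<pi> a \<otimes>\<^bsub>S\<^esub> \<pi> b"
  using ring_hom_mult[OF \<pi>_hom] by (simp add: free_alg_simps)

lemma \<pi>_add: "a \<in> carrier FA \<Longrightarrow> b \<in> carrier FA \<Longrightarrow> \<pi> (a + b) = \<pi> a \<oplus>\<^bsub>S\<^esub> \<pi> b"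
  using ring_hom_add[OF \<pi>_hom] by (simp add: free_alg_simps)

lemma \<pi>_one: "\<pi> 1 = \<one>\<^bsub>S\<^esub>"
  using ring_hom_one[OF \<pi>_hom] by (simp add: free_alg_simps)

lemma \<pi>_zero: "\<pi> 0 = \<zero>\<^bsub>S\<^esub>"
  using ring_hom_zero[OF \<pi>_hom ring_free_alg ring_S] by (simp add: free_alg_simps)

lemma \<pi>_uminus: "a \<in> carrier FA \<Longrightarrow> \<pi> (- a) = \<ominus>\<^bsub>S\<^esub> \<pi> a"
  by (rule abelian_group.minus_equality[OF ring.is_abelian_group[OF ring_S], symmetric])
    (simp_all add: \<pi>_add[symmetric] \<pi>_zero)

lemma S_cases:
  assumes "X \<in> carrier S"
  obtains a where "a \<in> carrier FA" "X = \<pi> a"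
  using assms A_RCOSETS_def'[of FA I] unfolding sym_alg_def sym_elem_def FactRing_def by auto

lemma \<pi>_eq_iff: "a \<in> carrier FA \<Longrightarrow> b \<in> carrier FA \<Longrightarrow> \<pi> a = \<pi> b \<longleftrightarrow> a - b \<in> I"
  using ring.quotient_eq_iff_same_a_r_cos[OF ring_free_alg ideal_I, of a b]
  by (auto simp: sym_elem_def free_alg_a_minus)

lemma mem_\<pi>: "b \<in> \<pi> a \<longleftrightarrow> b - a \<in> I"
proof -
  have "b \<in> \<pi> a \<longleftrightarrow> (\<exists>r\<in>I. b = r + a)"
    by (auto simp: sym_elem_def a_r_coset_def r_coset_def free_alg_simps)
  also have "\<dots> \<longleftrightarrow> b - a \<in> I" by (metis add_diff_cancel_right' diff_add_cancel)
  finally show ?thesis .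
qed

lemma \<pi>_weight_iff:
  assumes "a \<in> carrier FA"
  shows "\<pi> a \<in> sym_weight G \<mu> \<longleftrightarrow> (\<forall>h. h_act G h a - const (\<mu> h) * a \<in> I)"
proof
  assume "\<pi> a \<in> sym_weight G \<mu>"
  moreover have "a \<in> \<pi> a" by (simp add: mem_\<pi>)
  ultimately show "\<forall>h. h_act G h a - const (\<mu> h) * a \<in> I" unfolding sym_weight_def by blast
next
  assume *: "\<forall>h. h_act G h a - const (\<mu> h) * a \<in> I"
  have "h_act G h b - const (\<mu> h) * b \<in> I" if "b \<in> \<pi> a" for b h
  proof -
    have r: "b - a \<in> I" using that by (simp add: mem_\<pi>)
    have "h_act G h b - const (\<mu> h) * b
        = (h_act G h a - const (\<mu> h) * a) + (h_act G h (b - a) - const (\<mu> h) * (b - a))"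
      by (simp add: h_act_diff algebra_simps)
    also have "\<dots> \<in> I"
      by (rule I_add[OF spec[OF *] I_diff[OF h_act_I[OF r] I_mult_left[OF r]]]) simp
    finally show ?thesis .
  qed
  then show "\<pi> a \<in> sym_weight G \<mu>" using assms by (simp add: sym_weight_def)
qed

lemma sym_weight_cases:
  assumes "X \<in> sym_weight G \<mu>"
  obtains a where "a \<in> carrier FA" "X = \<pi> a" "\<forall>h. h_act G h a - const (\<mu> h) * a \<in> I"
proof -
  have "X \<in> carrier S" using assms by (simp add: sym_weight_def)
  then obtain a where "a \<in> carrier FA" "X = \<pi> a" by (rule S_cases)
  then show ?thesis using that assms \<pi>_weight_iff by blast
qed

lemma sym_weight_carrier: "X \<in> sym_weight G \<mu> \<Longrightarrow> X \<in> carrier S"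
  by (simp add: sym_weight_def)

lemma sym_weight_zero: "\<zero>\<^bsub>S\<^esub> \<in> sym_weight G \<mu>"
  unfolding \<pi>_zero[symmetric] by (subst \<pi>_weight_iff) (simp_all add: h_act_0)

lemma sym_weight_const: "\<pi> (const c) \<in> sym_weight G (\<lambda>h. 0)"
  by (subst \<pi>_weight_iff) (simp_all add: h_act_const)

lemma sym_weight_one: "\<one>\<^bsub>S\<^esub> \<in> sym_weight G (\<lambda>h. 0)"
  using sym_weight_const[of 1] by (simp add: \<pi>_one)

lemma sym_weight_add:
  assumes "X \<in> sym_weight G \<mu>" "Y \<in> sym_weight G \<mu>"
  shows "X \<oplus>\<^bsub>S\<^esub> Y \<in> sym_weight G \<mu>"
proof -
  obtain a where a: "a \<in> carrier FA" "X = \<pi> a" "\<forall>h. h_act G h a - const (\<mu> h) * a \<in> I"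
    using assms(1) by (rule sym_weight_cases)
  obtain b where b: "b \<in> carrier FA" "Y = \<pi> b" "\<forall>h. h_act G h b - const (\<mu> h) * b \<in> I"
    using assms(2) by (rule sym_weight_cases)
  have "h_act G h (a + b) - const (\<mu> h) * (a + b) \<in> I" for h
    using I_add[OF spec[OF a(3)] spec[OF b(3)], of h h] by (simp add: h_act_add algebra_simps)
  then show ?thesis using a b by (simp add: \<pi>_add[symmetric] \<pi>_weight_iff)
qed

lemma sym_weight_uminus:
  assumes "X \<in> sym_weight G \<mu>"
  shows "\<ominus>\<^bsub>S\<^esub> X \<in> sym_weight G \<mu>"
proof -
  obtain a where a: "a \<in> carrier FA" "X = \<pi> a" "\<forall>h. h_act G h a - const (\<mu> h) * a \<in> I"
    using assms(1) by (rule sym_weight_cases)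
  have "h_act G h (- a) - const (\<mu> h) * (- a) \<in> I" for h
    using I_uminus[OF spec[OF a(3)], of h] by (simp add: h_act_minus algebra_simps)
  then show ?thesis using a by (simp add: \<pi>_uminus[symmetric] \<pi>_weight_iff)
qed

lemma sym_weight_mult:
  assumes "X \<in> sym_weight G \<mu>" "Y \<in> sym_weight G \<nu>"
  shows "X \<otimes>\<^bsub>S\<^esub> Y \<in> sym_weight G (\<lambda>h. \<mu> h + \<nu> h)"
proof -
  obtain a where a: "a \<in> carrier FA" "X = \<pi> a" "\<forall>h. h_act G h a - const (\<mu> h) * a \<in> I"
    using assms(1) by (rule sym_weight_cases)
  obtain b where b: "b \<in> carrier FA" "Y = \<pi> b" "\<forall>h. h_act G h b - const (\<nu> h) * b \<in> I"
    using assms(2) by (rule sym_weight_cases)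
  have "h_act G h (a * b) - const (\<mu> h + \<nu> h) * (a * b) \<in> I" for h
  proof -
    have "a * (const (\<nu> h) * b) = const (\<nu> h) * (a * b)"
      by (metis const_commute mult.assoc)
    then have "h_act G h (a * b) - const (\<mu> h + \<nu> h) * (a * b)
        = (h_act G h a - const (\<mu> h) * a) * b + a * (h_act G h b - const (\<nu> h) * b)"
      by (simp add: h_act_mult single_add algebra_simps)
    then show ?thesis using a b by (simp add: I_add I_mult_left I_mult_right)
  qed
  then show ?thesis using a b by (simp add: \<pi>_mult[symmetric] \<pi>_weight_iff)
qed

lemma sym_weight_pow:
  assumes "X \<in> sym_weight G \<mu>"
  shows "X [^]\<^bsub>S\<^esub> (n::nat) \<in> sym_weight G (\<lambda>h. of_nat n * \<mu> h)"
proof (induction n)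
  case 0
  show ?case using sym_weight_one by simp
next
  case (Suc n)
  then show ?case using sym_weight_mult[OF Suc assms] by (simp add: algebra_simps)
qed

lemma B_word_FA: "set w \<subseteq> B \<Longrightarrow> word_single w c \<in> carrier FA"
  using B_V by (intro free_alg_word_single) blast

lemma sym_weight_word:
  assumes "set w \<subseteq> B" "\<And>h. \<mu> h = - wsum w h"
  shows "\<pi> (word_single w c) \<in> sym_weight G \<mu>"
  using h_act_word[OF assms(1)] assms by (simp add: \<pi>_weight_iff B_word_FA)

text \<open>
Expand a representative into words in \<open>B\<close>, which are weight vectors modulo the ideal. The part of
the expansion in words of other weights lies in the ideal.
\<close>

lemma sym_weight_words:
  assumes "X \<in> sym_weight G \<mu>"
  obtains a where "X = \<pi> a"
    "\<And>w. w \<in> Poly_Mapping.keys a \<Longrightarrow> set (letters w) \<subseteq> B \<and> (\<forall>h. \<mu> h = - wsum (letters w) h)"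
proof -
  interpret FV: vector_space "\<lambda>(c :: 'k) (a :: 'g word \<Rightarrow>\<^sub>0 'k). const c * a"
    by (rule vector_space_free_alg)
  have "X \<in> carrier S" using assms by (rule sym_weight_carrier)
  then obtain a0 where a0: "a0 \<in> carrier FA" "X = \<pi> a0" by (rule S_cases)
  then obtain a where a: "a \<in> carrier (free_alg B)" "a0 - a \<in> I" using FA_spanned by blast
  have aFA: "a \<in> carrier FA" using a(1) B_V unfolding mem_free_alg by blast
  have X: "X = \<pi> a" using a0 a aFA by (simp add: \<pi>_eq_iff)
  define T where "T = Poly_Mapping.keys a"
  define v where "v w = Poly_Mapping.single w (Poly_Mapping.lookup a w)" for w
  define wt' where "wt' w = (\<lambda>h. - wsum (letters w) h)" for w
  have T: "finite T" "\<And>w. w \<in> T \<Longrightarrow> set (letters w) \<subseteq> B"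
    using a(1) by (auto simp: T_def mem_free_alg)
  have sum_v: "(\<Sum>w\<in>T. v w) = a"
    unfolding T_def v_def by (rule poly_mapping_eq_sum_single[symmetric])
  have other: "(\<Sum>w | w \<in> T \<and> wt' w \<noteq> \<mu>. v w) \<in> I"
  proof (rule FV.other_weights_vanish[where f = "h_act G"])
    show "FV.subspace I" unfolding FV.subspace_def by (simp add: I_add I_mult_left)
    show "h_act G h (v w) - const (wt' w h) * v w \<in> I" if "w \<in> T" for w h
      using h_act_word[OF T(2)[OF that]] by (simp add: v_def wt'_def)
    show "h_act G h (sum v T) - const (\<mu> h) * sum v T \<in> I" for h
      using assms \<pi>_weight_iff[OF aFA] unfolding sum_v X by blast
  qed (simp_all add: h_act_add h_act_scale h_act_I T)
  define b where "b = (\<Sum>w | w \<in> T \<and> wt' w = \<mu>. v w)"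
  have "a = b + (\<Sum>w | w \<in> T \<and> wt' w \<noteq> \<mu>. v w)"
    unfolding b_def sum_v[symmetric] using T(1)
    by (subst sum.union_disjoint[symmetric]) (auto intro!: sum.cong)
  then have "a - b \<in> I" using other by simp
  moreover have keys_b: "Poly_Mapping.keys b \<subseteq> {w \<in> T. wt' w = \<mu>}"
    unfolding b_def by (rule order_trans[OF keys_sum]) (auto simp: v_def)
  moreover have "b \<in> carrier FA"
    using keys_b T(2) B_V unfolding mem_free_alg by blast
  ultimately show ?thesis using that[of b] X aFA T(2) by (auto simp: \<pi>_eq_iff wt'_def)
qed

definition sign_equiv :: "('g word \<Rightarrow>\<^sub>0 'k) \<Rightarrow> ('g word \<Rightarrow>\<^sub>0 'k) \<Rightarrow> bool" where
  "sign_equiv a b \<longleftrightarrow> a - b \<in> I \<or> a + b \<in> I"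

lemma sign_equiv_refl: "sign_equiv a a"
  by (simp add: sign_equiv_def)

lemma sign_equiv_trans:
  assumes "sign_equiv a b" "sign_equiv b c"
  shows "sign_equiv a c"
proof -
  have "(a - b) + (b - c) = a - c" "(a - b) + (b + c) = a + c"
    "(a + b) - (b - c) = a + c" "(a + b) - (b + c) = a - c"
    by simp_all
  then show ?thesis
    using assms I_add[of "a - b" "b - c"] I_add[of "a - b" "b + c"] I_diff[of "a + b" "b - c"]
      I_diff[of "a + b" "b + c"]
    unfolding sign_equiv_def by metis
qed

lemma sign_equiv_mult:
  assumes "sign_equiv a b" "x \<in> carrier FA"
  shows "sign_equiv (x * a) (x * b)" "sign_equiv (a * x) (b * x)"
  using assms I_mult_left[of "a - b" x] I_mult_left[of "a + b" x]
    I_mult_right[of "a - b" x] I_mult_right[of "a + b" x]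
  unfolding sign_equiv_def distrib_left distrib_right left_diff_distrib right_diff_distrib by blast+

lemma sign_equiv_swap:
  assumes "x \<in> B" "y \<in> B"
  shows "sign_equiv (letter x * letter y) (letter y * letter x)"
proof -
  have comm: "supercommutator (pr x) (pr y) x y \<in> I"
    using assms by (intro letter_commute B_V pr)
  show ?thesis
  proof (cases "pr x = 1 \<and> pr y = 1")
    case True
    show ?thesis
      using comm unfolding sign_equiv_def supercommutator_def koszul_def if_P[OF True]
      by (simp add: single_uminus)
  next
    case False
    show ?thesis
      using comm unfolding sign_equiv_def supercommutator_def koszul_def if_not_P[OF False]
      by simp
  qed
qed

lemma sign_equiv_move:
  assumes "set u \<subseteq> B" "x \<in> B" "set v \<subseteq> B"
  shows "sign_equiv (word_single (u @ x # v) 1) (word_single (x # u @ v) 1)"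
  using assms
proof (induction u)
  case Nil
  show ?case by (simp add: sign_equiv_refl)
next
  case (Cons y u)
  have "sign_equiv (letter y * word_single (u @ x # v) 1) (letter y * word_single (x # u @ v) 1)"
    using Cons B_V by (intro sign_equiv_mult) auto
  moreover have "sign_equiv (letter y * letter x * word_single (u @ v) 1) (letter x * letter y * word_single (u @ v) 1)"
    using Cons.prems B_V by (intro sign_equiv_mult sign_equiv_swap) (auto intro!: B_word_FA)
  ultimately have "sign_equiv (word_single (y # u @ x # v) 1) (word_single (y # x # u @ v) 1)"
    "sign_equiv (word_single (y # x # u @ v) 1) (word_single (x # y # u @ v) 1)"
    by (simp_all add: word_single_mult)
  then show ?case unfolding append_Cons by (rule sign_equiv_trans)
qed

text \<open>
The first letter of one word is moved to the front of the other word by exchanging neighbours, each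
time with a sign.
\<close>

lemma sign_equiv_mset_eq:
  "mset u = mset v \<Longrightarrow> set u \<subseteq> B \<Longrightarrow> sign_equiv (word_single u 1) (word_single v 1)"
proof (induction u arbitrary: v)
  case Nil
  then show ?case by (simp add: sign_equiv_refl)
next
  case (Cons x u)
  then have "x \<in> set v" by (metis list.set_intros(1) mset_eq_setD)
  then obtain p s where v: "v = p @ x # s" by (meson split_list)
  have ps: "set p \<subseteq> B" "set s \<subseteq> B" "x \<in> B"
    using Cons.prems mset_eq_setD[OF Cons.prems(1)] unfolding v by auto
  have "sign_equiv (letter x * word_single u 1) (letter x * word_single (p @ s) 1)"
    using Cons ps B_V by (intro sign_equiv_mult Cons.IH) (auto simp: v)
  then have "sign_equiv (word_single (x # u) 1) (word_single (x # p @ s) 1)"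
    by (simp add: word_single_mult)
  moreover have "sign_equiv (word_single (x # p @ s) 1) (word_single v 1)"
    using sign_equiv_move[OF ps(1,3,2)] unfolding v sign_equiv_def
    by (metis I_minus_iff add.commute)
  ultimately show ?case by (rule sign_equiv_trans)
qed

text \<open>
An even element commutes with all generators. For an odd element the relation of the element with
itself says that twice its square is zero.
\<close>

lemma letter_central_or_square_zero:
  assumes "x \<in> V" "x \<in> grade G p"
  shows "(\<forall>X\<in>carrier S. X \<otimes>\<^bsub>S\<^esub> \<pi> (letter x) = \<pi> (letter x) \<otimes>\<^bsub>S\<^esub> X)
    \<or> \<pi> (letter x) \<otimes>\<^bsub>S\<^esub> \<pi> (letter x) = \<zero>\<^bsub>S\<^esub>"
proof (cases "p = 1")
  case True
  have "letter x * letter x + letter x * letter x \<in> I"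
    using letter_commute[OF assms assms] by (simp add: True supercommutator_def koszul_def single_uminus)
  then have "const (1 / 2) * (letter x * letter x + letter x * letter x) \<in> I"
    by (rule I_mult_left) simp
  moreover have "const (1 / 2 :: 'k) * (a + a) = a" for a :: "'g word \<Rightarrow>\<^sub>0 'k"
    by (simp add: distrib_left distrib_right[symmetric] single_add[symmetric])
  ultimately have "letter x * letter x \<in> I" by simp
  then show ?thesis using assms by (simp add: \<pi>_mult[symmetric] \<pi>_zero[symmetric] \<pi>_eq_iff)
next
  case False
  have comm: "a * letter x - letter x * a \<in> I" if "a \<in> carrier (free_alg B)" for a
  proof (induction a rule: poly_mapping_keys_induct)
    case (1 w)
    let ?c = "Poly_Mapping.lookup a w"
    obtain u where w: "w = Word u" by (cases w)
    have "set u \<subseteq> B" using 1 that unfolding w mem_free_alg by fastforce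
    then have "word_single u ?c * letter x - letter x * word_single u ?c \<in> I"
    proof (induction u)
      case Nil
      show ?case by (simp add: word_single_mult)
    next
      case (Cons b u)
      have b: "b \<in> B" "b \<in> V" "word_single u ?c \<in> carrier FA" using Cons.prems B_V by (auto intro!: B_word_FA)
      have "letter b * (word_single u ?c * letter x - letter x * word_single u ?c)
          - supercommutator p (pr b) x b * word_single u ?c \<in> I"
      proof (rule I_diff[OF I_mult_left I_mult_right])
        show "supercommutator p (pr b) x b \<in> I" using b assms pr by (intro letter_commute)
      qed (use Cons b in auto)
      also have "letter b * (word_single u ?c * letter x - letter x * word_single u ?c)
          - supercommutator p (pr b) x b * word_single u ?c
          = word_single (b # u) ?c * letter x - letter x * word_single (b # u) ?c"
        using False by (simp add: supercommutator_def koszul_def right_diff_distrib left_diff_distrib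
            word_single_mult)
      finally show ?case .
    qed
    then show ?case by (simp add: w)
  next
    case (3 a b)
    then show ?case using I_add[OF 3] by (simp add: algebra_simps)
  qed simp
  have "X \<otimes>\<^bsub>S\<^esub> \<pi> (letter x) = \<pi> (letter x) \<otimes>\<^bsub>S\<^esub> X" if X0: "X \<in> carrier S" for X
  proof -
    obtain a0 where a0: "a0 \<in> carrier FA" "X = \<pi> a0" using X0 by (rule S_cases)
    then obtain a where a: "a \<in> carrier (free_alg B)" "a0 - a \<in> I" using FA_spanned by blast
    have aFA: "a \<in> carrier FA" using a(1) B_V unfolding mem_free_alg by blast
    have X: "X = \<pi> a" using a0 a aFA by (simp add: \<pi>_eq_iff)
    show ?thesis unfolding X using assms aFA comm[OF a(1)]
      by (simp add: \<pi>_mult[symmetric] \<pi>_eq_iff)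
  qed
  then show ?thesis by blast
qed

end

section \<open>Fractions of words and their exponents\<close>

text \<open>
The localization of \<open>S(n\<^sup>-)\<close> at a vector \<open>e\<close> of weight \<open>- \<alpha>\<close>.
\<close>

locale localized_generators = homogeneous_generators G B pr wt
  for G :: "('k::field_char_0, 'g::ab_group_add, 'h, 'i::finite) superdata" and B pr wt +
  fixes \<alpha> :: "'h \<Rightarrow> 'k" and e :: 'g and p :: bit
  assumes e_V: "e \<in> V" and e_grade: "e \<in> grade G p"
    and e_weight: "e \<in> root_space G (\<lambda>h. - \<alpha> h)"
begin

abbreviation "\<epsilon> \<equiv> \<pi> (letter e)"

sublocale fractions S \<epsilon>
proof -
  interpret ring S by (rule ring_S)
  show "fractions S \<epsilon>"
    by unfold_locales (use e_V letter_central_or_square_zero[OF e_V e_grade] in auto)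
qed

lemma E_weight: "\<epsilon> \<in> sym_weight G (\<lambda>h. - \<alpha> h)"
proof -
  have "h_act G h (letter e) - const (- \<alpha> h) * letter e \<in> I" for h
    using letter_scl[OF e_V, of "- \<alpha> h"] e_weight by (simp add: h_act_letter root_space_def)
  then show ?thesis using e_V by (simp add: \<pi>_weight_iff)
qed

lemma sym_loc_weight_def':
  "sym_loc_weight G \<alpha> e \<mu> = {fr s m | s m. s \<in> sym_weight G (\<lambda>h. \<mu> h - of_nat m * \<alpha> h)}"
  by (simp add: sym_loc_weight_def)

lemma sym_loc_weightI:
  "s \<in> sym_weight G \<nu> \<Longrightarrow> (\<And>h. \<nu> h = \<mu> h - of_nat m * \<alpha> h) \<Longrightarrow> fr s m \<in> sym_loc_weight G \<alpha> e \<mu>"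
proof -
  assume "s \<in> sym_weight G \<nu>" "\<And>h. \<nu> h = \<mu> h - of_nat m * \<alpha> h"
  moreover from this(2) have "\<nu> = (\<lambda>h. \<mu> h - of_nat m * \<alpha> h)" by blast
  ultimately show ?thesis unfolding sym_loc_weight_def' by blast
qed

lemma sym_loc_weightE:
  assumes "X \<in> sym_loc_weight G \<alpha> e \<mu>"
  obtains s m where "s \<in> carrier S" "s \<in> sym_weight G (\<lambda>h. \<mu> h - of_nat m * \<alpha> h)" "X = fr s m"
  using assms sym_weight_carrier unfolding sym_loc_weight_def' by blast

lemma sym_loc_weight_closed: "sym_loc_weight G \<alpha> e \<mu> \<subseteq> carrier Loc"
  by (auto elim!: sym_loc_weightE)

lemma sym_loc_weight_zero: "\<zero>\<^bsub>Loc\<^esub> \<in> sym_loc_weight G \<alpha> e \<mu>"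
  unfolding fr_zero[symmetric, of 0] by (rule sym_loc_weightI[OF sym_weight_zero refl])

lemma sym_loc_weight_mult:
  assumes "X \<in> sym_loc_weight G \<alpha> e \<mu>" "Y \<in> sym_loc_weight G \<alpha> e \<nu>" "\<And>h. \<kappa> h = \<mu> h + \<nu> h"
  shows "X \<otimes>\<^bsub>Loc\<^esub> Y \<in> sym_loc_weight G \<alpha> e \<kappa>"
proof -
  obtain s m where s: "s \<in> carrier S" "s \<in> sym_weight G (\<lambda>h. \<mu> h - of_nat m * \<alpha> h)" "X = fr s m"
    using assms(1) by (rule sym_loc_weightE)
  obtain t n where t: "t \<in> carrier S" "t \<in> sym_weight G (\<lambda>h. \<nu> h - of_nat n * \<alpha> h)" "Y = fr t n"
    using assms(2) by (rule sym_loc_weightE)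
  show ?thesis
    unfolding s(3) t(3) Loc_mult[OF s(1) t(1)]
    by (rule sym_loc_weightI[OF sym_weight_mult[OF s(2) t(2)]]) (simp add: assms(3) algebra_simps)
qed

text \<open>
Over the common denominator the numerators are multiplied by powers of \<open>e\<close>, whose weights account
for the change of the denominators.
\<close>

lemma sym_loc_weight_add:
  assumes "X \<in> sym_loc_weight G \<alpha> e \<mu>" "Y \<in> sym_loc_weight G \<alpha> e \<mu>"
  shows "X \<oplus>\<^bsub>Loc\<^esub> Y \<in> sym_loc_weight G \<alpha> e \<mu>"
proof -
  obtain s m where s: "s \<in> carrier S" "s \<in> sym_weight G (\<lambda>h. \<mu> h - of_nat m * \<alpha> h)" "X = fr s m"
    using assms(1) by (rule sym_loc_weightE)
  obtain t n where t: "t \<in> carrier S" "t \<in> sym_weight G (\<lambda>h. \<mu> h - of_nat n * \<alpha> h)" "Y = fr t n"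
    using assms(2) by (rule sym_loc_weightE)
  let ?\<nu> = "\<lambda>h. \<mu> h - of_nat (m + n) * \<alpha> h"
  have "\<epsilon> [^]\<^bsub>S\<^esub> n \<otimes>\<^bsub>S\<^esub> s \<in> sym_weight G ?\<nu>" "\<epsilon> [^]\<^bsub>S\<^esub> m \<otimes>\<^bsub>S\<^esub> t \<in> sym_weight G ?\<nu>"
    using sym_weight_mult[OF sym_weight_pow[OF E_weight, of n] s(2)]
      sym_weight_mult[OF sym_weight_pow[OF E_weight, of m] t(2)]
    by (simp_all add: algebra_simps)
  then show ?thesis
    unfolding s(3) t(3) Loc_add[OF s(1) t(1)] by (intro sym_loc_weightI[OF sym_weight_add]) simp_all
qed

lemma sym_loc_weight_minus:
  assumes "X \<in> sym_loc_weight G \<alpha> e \<mu>"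
  shows "\<ominus>\<^bsub>Loc\<^esub> X \<in> sym_loc_weight G \<alpha> e \<mu>"
proof -
  obtain s m where s: "s \<in> carrier S" "s \<in> sym_weight G (\<lambda>h. \<mu> h - of_nat m * \<alpha> h)" "X = fr s m"
    using assms(1) by (rule sym_loc_weightE)
  show ?thesis unfolding s(3) Loc_minus[OF s(1)]
    by (rule sym_loc_weightI[OF sym_weight_uminus[OF s(2)]]) simp
qed

lemma sym_loc_const_weight: "sym_loc_const G e c \<in> sym_loc_weight G \<alpha> e (\<lambda>h. 0)"
  unfolding sym_loc_const_def by (rule sym_loc_weightI[OF sym_weight_const]) simp

abbreviation sap_weight :: "('h \<Rightarrow> 'k) \<Rightarrow> nat \<Rightarrow> (('g word \<Rightarrow>\<^sub>0 'k) set \<times> nat) set set" where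
  "sap_weight \<tau> k \<equiv> sym_loc_weight G \<alpha> e (\<lambda>h. - (of_nat k * \<tau> h))"

lemma sapovalov_algebra_eq:
  "sapovalov_algebra G \<alpha> e \<tau> = Loc\<lparr>carrier := ring.graded_sums Loc (sap_weight \<tau>)\<rparr>"
  by (simp add: sapovalov_algebra_def sym_loc_def ring.graded_sums_def[OF ring_Loc])

lemma subring_sapovalov: "subring (ring.graded_sums Loc (sap_weight \<tau>)) Loc"
proof (rule ring.subring_graded_sums[OF ring_Loc])
  show "\<one>\<^bsub>Loc\<^esub> \<in> sap_weight \<tau> 0"
    unfolding Loc_one by (rule sym_loc_weightI[OF sym_weight_one]) simp
  show "X \<otimes>\<^bsub>Loc\<^esub> Y \<in> sap_weight \<tau> (k + l)" if "X \<in> sap_weight \<tau> k" "Y \<in> sap_weight \<tau> l" for X Y k l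
    using that by (rule sym_loc_weight_mult) (simp add: algebra_simps)
qed (simp_all add: sym_loc_weight_closed sym_loc_weight_zero sym_loc_weight_add sym_loc_weight_minus)

definition frac_word :: "'g list \<Rightarrow> nat \<Rightarrow> (('g word \<Rightarrow>\<^sub>0 'k) set \<times> nat) set" where
  "frac_word w m = fr (\<pi> (word_single w 1)) m"

lemma frac_word_append:
  assumes "set u \<subseteq> B" "set v \<subseteq> B"
  shows "frac_word (u @ v) (m + n) = frac_word u m \<otimes>\<^bsub>Loc\<^esub> frac_word v n"
  using assms by (simp add: frac_word_def Loc_mult B_word_FA \<pi>_mult[symmetric] word_single_mult)

lemma frac_word_mset_eq:
  assumes "mset u = mset v" "set u \<subseteq> B"
  shows "frac_word u m = frac_word v m \<or> frac_word u m = \<ominus>\<^bsub>Loc\<^esub> frac_word v m"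
proof -
  have v: "set v \<subseteq> B" using assms mset_eq_setD by blast
  let ?u = "word_single u 1 :: 'g word \<Rightarrow>\<^sub>0 'k" and ?v = "word_single v 1 :: 'g word \<Rightarrow>\<^sub>0 'k"
  have FA: "?u \<in> carrier FA" "?v \<in> carrier FA" using assms v by (auto intro!: B_word_FA)
  have "?u - ?v \<in> I \<or> ?u - (- ?v) \<in> I"
    using sign_equiv_mset_eq[OF assms] unfolding sign_equiv_def by simp
  then have "\<pi> ?u = \<pi> ?v \<or> \<pi> ?u = \<pi> (- ?v)"
    using FA by (simp only: \<pi>_eq_iff free_alg_uminus)
  then show ?thesis using FA by (auto simp: frac_word_def \<pi>_uminus Loc_minus)
qed

text \<open>
The exponents of the fraction \<open>w / e^m\<close> in degree \<open>k\<close> as one multiset, so that Dickson's lemma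
applies to all of them at once: \<open>Inr False\<close> counts the factors \<open>e\<close> of the denominator and
\<open>Inr True\<close> counts the degree.
\<close>

definition exponents :: "'g list \<Rightarrow> nat \<Rightarrow> nat \<Rightarrow> ('g + bool) multiset" where
  "exponents w m k = image_mset Inl (mset w)
     + replicate_mset m (Inr False) + replicate_mset k (Inr True)"

lemma exponents_append:
  "exponents (u @ v) (m + n) (k + l) = exponents u m k + exponents v n l"
  by (rule multiset_eqI) (simp add: exponents_def)

lemma exponents_surj: "\<exists>w m k. exponents w m k = M"
proof (induction M)
  case empty
  have "exponents [] 0 0 = {#}" by (simp add: exponents_def)
  then show ?case by blast
next
  case (add x M)
  then obtain w m k where M: "exponents w m k = M" by blast
  have "exponents (b # w) m k = add_mset (Inl b) M" "exponents w (Suc m) k = add_mset (Inr False) M"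
    "exponents w m (Suc k) = add_mset (Inr True) M" for b
    unfolding M[symmetric] by (simp_all add: exponents_def)
  moreover have "x = Inr False \<or> x = Inr True" if "\<And>b. x \<noteq> Inl b"
    using that by (cases x) auto
  ultimately show ?case by metis
qed

lemma exponents_inj:
  assumes "exponents u m k = exponents v n l"
  shows "mset u = mset v" "m = n"
proof -
  have "count (mset u) b = count (mset v) b" for b
  proof -
    have "count (image_mset Inl (mset w)) (Inl b :: 'g + bool) = count (mset w) b" for w :: "'g list"
      by (induction w) auto
    then show ?thesis
      using arg_cong[OF assms, of "\<lambda>M. count M (Inl b)"] by (simp add: exponents_def)
  qed
  then show "mset u = mset v" by (rule multiset_eqI)
  have "count (image_mset Inl (mset w)) (Inr False :: 'g + bool) = 0" for w :: "'g list"
    by (auto simp: count_eq_zero_iff)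
  then show "m = n"
    using arg_cong[OF assms, of "\<lambda>M. count M (Inr False)"] by (simp add: exponents_def)
qed

text \<open>
The exponents that give the fraction \<open>w / e^m\<close> the weight \<open>- k\<tau>\<close>: the solutions of the equation that the
roots of the letters of \<open>w\<close> add up to \<open>m\<alpha> + k\<tau>\<close>.
\<close>

definition homogeneous_exponents :: "('h \<Rightarrow> 'k) \<Rightarrow> ('g + bool) multiset set" where
  "homogeneous_exponents \<tau> =
     {M. set_mset M \<subseteq> Inl ` B \<union> range Inr \<and>
       (\<forall>h. (\<Sum>x\<in>#M. case x of Inl b \<Rightarrow> wt b h | Inr False \<Rightarrow> - \<alpha> h | Inr True \<Rightarrow> - \<tau> h) = 0)}"

lemma exponents_homogeneous_iff:
  "exponents w m k \<in> homogeneous_exponents \<tau> \<longleftrightarrow>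
     set w \<subseteq> B \<and> (\<forall>h. wsum w h = of_nat m * \<alpha> h + of_nat k * \<tau> h)"
proof -
  have "set_mset (exponents w m k) \<subseteq> Inl ` B \<union> range Inr \<longleftrightarrow> set w \<subseteq> B"
    by (auto simp: exponents_def)
  moreover have "(\<Sum>x\<in>#exponents w m k. case x of Inl b \<Rightarrow> wt b h | Inr False \<Rightarrow> - \<alpha> h | Inr True \<Rightarrow> - \<tau> h)
      = wsum w h - (of_nat m * \<alpha> h + of_nat k * \<tau> h)" for h
    by (simp add: exponents_def wsum_def image_mset.compositionality o_def sum_mset_sum_list[symmetric])
  ultimately show ?thesis by (simp add: homogeneous_exponents_def)
qed

lemma homogeneous_exponents_generated:
  obtains A where "finite A" "A \<subseteq> homogeneous_exponents \<tau>"
    "\<And>M. M \<in> homogeneous_exponents \<tau> \<Longrightarrow> \<exists>\<A>. set_mset \<A> \<subseteq> A \<and> M = \<Sum>\<^sub># \<A>"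
proof (rule difference_closed_finitely_generated[where L = "homogeneous_exponents \<tau>" and B = "Inl ` B \<union> range Inr"])
  show "finite (Inl ` B \<union> range (Inr :: bool \<Rightarrow> _))" using finite_B by simp
  show "M - N \<in> homogeneous_exponents \<tau>"
    if M: "M \<in> homogeneous_exponents \<tau>" and N: "N \<in> homogeneous_exponents \<tau>" and "N \<subseteq># M" for M N
  proof -
    obtain D where D: "M = N + D" using \<open>N \<subseteq># M\<close> by (auto simp: subset_mset.le_iff_add)
    then show ?thesis using M N by (simp add: homogeneous_exponents_def)
  qed
qed (auto simp: homogeneous_exponents_def)

text \<open>
A weight vector of weight \<open>- k\<tau>\<close> is a combination of fractions of words with homogeneous exponents.
Writing the exponents as a sum of generators of the monoid writes the fraction, up to sign, as a
product of the fractions that belong to these generators.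
\<close>

theorem finitely_generated_sapovalov:
  "finitely_generated_algebra (sym_loc_const G e) (sapovalov_algebra G \<alpha> e \<tau>)"
proof -
  interpret L: ring Loc by (rule ring_Loc)
  define C where "C = L.graded_sums (sap_weight \<tau>)"
  have subring_C: "subring C Loc" unfolding C_def by (rule subring_sapovalov)
  have weight_C: "sap_weight \<tau> k \<subseteq> C" for k
    unfolding C_def
    by (rule L.graded_sums_homogeneous)
      (auto simp: sym_loc_weight_zero sym_loc_weight_add intro: subsetD[OF sym_loc_weight_closed])
  obtain A where A: "finite A" "A \<subseteq> homogeneous_exponents \<tau>"
    "\<And>M. M \<in> homogeneous_exponents \<tau> \<Longrightarrow> \<exists>\<A>. set_mset \<A> \<subseteq> A \<and> M = \<Sum>\<^sub># \<A>"
    by (rule homogeneous_exponents_generated[of \<tau>]) blast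
  have "\<forall>M. \<exists>w m k. exponents w m k = M" by (intro allI exponents_surj)
  then obtain W D K where WDK: "\<And>M. exponents (W M) (D M) (K M) = M"
    by metis
  define X where "X = (\<lambda>M. frac_word (W M) (D M)) ` A"
  define Gen where "Gen = generate_ring Loc (range (sym_loc_const G e) \<union> X)"
  have word_weight: "frac_word w m \<in> sap_weight \<tau> k"
    if "exponents w m k \<in> homogeneous_exponents \<tau>" for w m k
    unfolding frac_word_def using that
    by (intro sym_loc_weightI[OF sym_weight_word[OF _ refl]]) (auto simp: exponents_homogeneous_iff)
  have A_exponents: "exponents (W M) (D M) (K M) \<in> homogeneous_exponents \<tau>" if "M \<in> A" for M
    unfolding WDK using that A(2) by blast
  have A_words: "set (W M) \<subseteq> B" if "M \<in> A" for M
    using A_exponents[OF that] exponents_homogeneous_iff by blast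
  have X_C: "X \<subseteq> C"
    using word_weight[OF A_exponents] weight_C unfolding X_def by blast
  have const_C: "range (sym_loc_const G e) \<subseteq> C"
  proof -
    have "sym_loc_const G e c \<in> sap_weight \<tau> 0" for c
      using sym_loc_const_weight[of c] by simp
    then show ?thesis using weight_C by blast
  qed
  have C_closed: "C \<subseteq> carrier Loc" by (rule subringE(1)[OF subring_C])
  have Gen_subring: "subring Gen Loc"
    unfolding Gen_def using X_C const_C C_closed by (intro L.generate_ring_is_subring) blast
  \<comment> \<open>The word is arbitrary here: every word with the given exponents is covered, as the letters can be
    rearranged up to sign.\<close>
  have word_Gen: "frac_word w m \<in> Gen"
    if "set_mset \<A> \<subseteq> A" "exponents w m k = \<Sum>\<^sub># \<A>" for \<A> w m k
    using that
  proof (induction \<A> arbitrary: w m k)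
    case empty
    then have "w = []" "m = 0" by (simp_all add: exponents_def)
    then have "frac_word w m = \<one>\<^bsub>Loc\<^esub>"
      by (simp add: frac_word_def Loc_one \<pi>_one[symmetric] word_single_Nil)
    then show ?case using subringE(3)[OF Gen_subring] by simp
  next
    case (add M \<A>)
    obtain w' m' k' where w': "exponents w' m' k' = \<Sum>\<^sub># \<A>"
      using exponents_surj by blast
    have M: "M \<in> A" using add.prems by simp
    have "exponents w m k = exponents (W M @ w') (D M + m') (K M + k')"
      using add.prems(2) by (simp add: exponents_append WDK w')
    note eq = exponents_inj[OF this]
    have "\<Sum>\<^sub># \<A> \<in> homogeneous_exponents \<tau>" 
      using A(2) add.prems(1) 
      by (induction \<A>) (auto simp: homogeneous_exponents_def)
    then have B: "set w' \<subseteq> B" "set (W M) \<subseteq> B"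
      using A_words[OF M] by (simp_all add: w'[symmetric] exponents_homogeneous_iff)
    have "frac_word (W M) (D M) \<in> Gen"
      unfolding Gen_def X_def using M by (intro generate_ring.incl) blast
    moreover have "frac_word w' m' \<in> Gen" using add w' by simp
    ultimately have "frac_word (W M @ w') m \<in> Gen"
      unfolding eq(2) frac_word_append[OF B(2,1)] by (rule subringE(6)[OF Gen_subring])
    moreover have "set w \<subseteq> B"
      using mset_eq_setD[OF eq(1)] B by simp
    ultimately show ?case
      using frac_word_mset_eq[OF eq(1), of m] subringE(5)[OF Gen_subring] by auto
  qed
  have weight_Gen: "sap_weight \<tau> k \<subseteq> Gen" for k
  proof
    fix Y assume "Y \<in> sap_weight \<tau> k"
    then obtain s m where s: "s \<in> sym_weight G (\<lambda>h. - (of_nat k * \<tau> h) - of_nat m * \<alpha> h)" "Y = fr s m"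
      by (rule sym_loc_weightE)
    obtain a where a: "s = \<pi> a" "\<And>w. w \<in> Poly_Mapping.keys a \<Longrightarrow> set (letters w) \<subseteq> B \<and>
        (\<forall>h. - (of_nat k * \<tau> h) - of_nat m * \<alpha> h = - wsum (letters w) h)"
      using s(1) by (rule sym_weight_words) blast
    have "a \<in> carrier FA \<and> fr (\<pi> a) m \<in> Gen"
    proof (induction a rule: poly_mapping_keys_induct)
      case (1 w)
      let ?c = "Poly_Mapping.lookup a w"
      obtain u where w: "w = Word u" by (cases w)
      have u: "set u \<subseteq> B" "\<And>h. - (of_nat k * \<tau> h) - of_nat m * \<alpha> h = - wsum u h"
        using a(2)[OF 1] by (simp_all add: w)
      have "wsum u h = of_nat m * \<alpha> h + of_nat k * \<tau> h" for h
        using u(2)[of h] by (simp add: algebra_simps minus_equation_iff)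
      then have "exponents u m k \<in> homogeneous_exponents \<tau>"
        using u(1) by (simp add: exponents_homogeneous_iff)
      then have "frac_word u m \<in> Gen" using A(3) word_Gen by metis
      moreover have "sym_loc_const G e ?c \<in> Gen"
        unfolding Gen_def by (intro generate_ring.incl) blast
      ultimately have "sym_loc_const G e ?c \<otimes>\<^bsub>Loc\<^esub> frac_word u m \<in> Gen"
        using subringE(6)[OF Gen_subring] by blast
      also have "sym_loc_const G e ?c \<otimes>\<^bsub>Loc\<^esub> frac_word u m = fr (\<pi> (word_single u ?c)) m"
        using u(1) by (simp add: sym_loc_const_def frac_word_def Loc_mult B_word_FA
            \<pi>_mult[symmetric] const_mult_word_single)
      finally show ?case using u(1) by (simp add: w B_word_FA)
    next
      case 2
      show ?case using subringE(2)[OF Gen_subring] by (simp add: \<pi>_zero fr_zero)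
    next
      case (3 x y)
      then show ?case
        using subringE(7)[OF Gen_subring] by (simp add: \<pi>_add Loc_add_same[symmetric])
    qed
    then show "Y \<in> Gen" by (simp add: s(2) a(1))
  qed
  have "C \<subseteq> Gen"
    unfolding C_def using weight_Gen subringE(1,7)[OF Gen_subring]
    by (intro L.graded_sums_subset) blast+
  moreover have "Gen \<subseteq> C"
    unfolding Gen_def using X_C const_C C_closed
    by (intro L.generate_ring_min_subring1[OF _ subring_C]) blast+
  ultimately have "generate_ring (Loc\<lparr>carrier := C\<rparr>) (range (sym_loc_const G e) \<union> X) = C"
    unfolding Gen_def using L.generate_ring_subring_eq[OF subring_C] X_C const_C by simp
  moreover have "finite X" unfolding X_def using A(1) by simp
  ultimately show ?thesis
    unfolding finitely_generated_algebra_def sapovalov_algebra_eq C_def[symmetric]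
    using X_C by auto
qed

end

section \<open>Homogeneity of root spaces\<close>

fun monomial_degree :: "('i, 'h) chevalley monomial \<Rightarrow> 'i \<Rightarrow> int" where
  "monomial_degree (Leaf (E i)) = (\<lambda>j. if j = i then 1 else 0)"
| "monomial_degree (Leaf (F i)) = (\<lambda>j. if j = i then - 1 else 0)"
| "monomial_degree (Leaf (H x)) = (\<lambda>j. 0)"
| "monomial_degree (Node u v) = (\<lambda>j. monomial_degree u j + monomial_degree v j)"

text \<open>
The generators \<open>E i\<close> and \<open>F i\<close> have opposite degrees but the same parity; this fits together
because \<open>- 1 = 1\<close> in the two-element field.
\<close>

lemma mono_par_eq_degree:
  "mono_par p u = (\<Sum>j\<in>UNIV. of_int (monomial_degree u j) * p (j :: 'i :: finite))"
proof (induction u)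
  case (Leaf x)
  show ?case
  proof (cases x)
    case (E i)
    have "(\<Sum>j\<in>UNIV. of_int (monomial_degree (Leaf x) j) * p j) = (\<Sum>j\<in>UNIV. if j = i then p j else 0)"
      unfolding E by (intro sum.cong) auto
    then show ?thesis by (simp add: E)
  next
    case (F i)
    have "(\<Sum>j\<in>UNIV. of_int (monomial_degree (Leaf x) j) * p j) = (\<Sum>j\<in>UNIV. if j = i then p j else 0)"
      unfolding F by (intro sum.cong) auto
    then show ?thesis by (simp add: F)
  next
    case (H h)
    then show ?thesis by simp
  qed
next
  case (Node u v)
  show ?case
    unfolding mono_par.simps monomial_degree.simps Node of_int_add distrib_right sum.distrib ..
qed

text \<open>
A contragredient Lie superalgebra with a chosen presentation \<open>\<phi>\<close>.
\<close>

locale chevalley_presentation =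
  fixes G :: "('k::field_char_0, 'g::ab_group_add, 'h::ab_group_add, 'i::finite) superdata"
    and \<phi> :: "(('i, 'h) chevalley monomial \<Rightarrow>\<^sub>0 'k) \<Rightarrow> 'g"
  assumes lie: "lie_superalgebra G" and realization: "minimal_realization G"
    and evec_grade: "evec G i \<in> grade G (par G i)" and fvec_grade: "fvec G i \<in> grade G (par G i)"
    and emb_even: "range (emb G) \<subseteq> grade G 0"
    and \<phi>_linear: "Vector_Spaces.linear na_scl (scl G) \<phi>" and \<phi>_surj: "surj \<phi>"
    and \<phi>_brk: "\<phi> (na_brk a b) = brk G (\<phi> a) (\<phi> b)"
    and \<phi>_E: "\<phi> (leaf (E i)) = evec G i" and \<phi>_F: "\<phi> (leaf (F i)) = fvec G i"
    and \<phi>_H: "\<phi> (leaf (H x)) = emb G x"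
    and \<phi>_kernel: "{a. \<phi> a = 0} = maximal_ideal G"
begin

sublocale g: vector_space "scl G"
  using lie by (simp add: lie_superalgebra_def)

sublocale na: vector_space "na_scl :: 'k \<Rightarrow> (('i, 'h) chevalley monomial \<Rightarrow>\<^sub>0 'k) \<Rightarrow> _"
  using \<phi>_linear by (simp add: Vector_Spaces.linear_iff)

lemma \<phi>_add: "\<phi> (a + b) = \<phi> a + \<phi> b" and \<phi>_scl: "\<phi> (na_scl c a) = scl G c (\<phi> a)"
  using \<phi>_linear by (simp_all add: Vector_Spaces.linear_iff)

lemma \<phi>_0: "\<phi> 0 = 0"
  using \<phi>_add[of 0 0] by simp

lemma \<phi>_diff: "\<phi> (a - b) = \<phi> a - \<phi> b"
  using \<phi>_add[of "a - b" b] by (simp add: algebra_simps)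

lemma na_ideal_presentation: "na_ideal (presentation_ideal G)"
  unfolding presentation_ideal_def
proof (rule hull_in)
  fix T :: "(('i, 'h) chevalley monomial \<Rightarrow>\<^sub>0 'k) set set"
  assume T: "Ball T na_ideal"
  have "na.subspace (\<Inter>T)" using T na.subspace_Inter[of T] by (auto simp: na_ideal_def)
  then show "na_ideal (\<Inter>T)" using T by (auto simp: na_ideal_def)
qed

text \<open>
The presentation ideal is itself one of the ideals whose sum is the kernel of \<open>\<phi>\<close>.
\<close>

lemma chevalley_relation: "r \<in> chevalley_rels G \<Longrightarrow> \<phi> r = 0"
proof -
  assume "r \<in> chevalley_rels G"
  then have "r \<in> presentation_ideal G" unfolding presentation_ideal_def by (intro hull_inc) simp
  moreover have "presentation_ideal G \<subseteq> maximal_ideal G"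
    unfolding maximal_ideal_def by (rule order_trans[OF _ na.span_superset])
      (use na_ideal_presentation in blast)
  ultimately show "\<phi> r = 0" using \<phi>_kernel by blast
qed

lemma brk_add_right: "brk G x (y + z) = brk G x y + brk G x z"
  and brk_scl_right: "brk G x (scl G c y) = scl G c (brk G x y)"
  and brk_scl_left: "brk G (scl G c x) y = scl G c (brk G x y)"
  using lie by (simp_all add: lie_superalgebra_def Vector_Spaces.linear_iff)

lemma brk_0_left: "brk G 0 y = 0"
  using brk_scl_left[of 0 0 y] by simp

lemma brk_0_right: "brk G x 0 = 0"
  using brk_scl_right[of x 0 0] by simp

lemma brk_emb_emb: "brk G (emb G x) (emb G y) = 0"
proof -
  have "na_brk (leaf (H x)) (leaf (H y)) \<in> chevalley_rels G"
    unfolding chevalley_rels_def by (rule UnI1, rule UnI1, rule UnI1, rule UnI1, rule UnI2) blast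
  from chevalley_relation[OF this] show ?thesis
    by (simp add: \<phi>_brk \<phi>_H)
qed

lemma brk_emb_evec: "brk G (emb G x) (evec G i) = scl G (sroot G i x) (evec G i)"
proof -
  have "na_brk (leaf (H x)) (leaf (E i)) - na_scl (sroot G i x) (leaf (E i)) \<in> chevalley_rels G"
    unfolding chevalley_rels_def by (rule UnI1, rule UnI1, rule UnI1, rule UnI2) blast
  from chevalley_relation[OF this] show ?thesis
    by (simp add: \<phi>_diff \<phi>_scl \<phi>_brk \<phi>_H \<phi>_E)
qed

lemma brk_emb_fvec: "brk G (emb G x) (fvec G i) = scl G (- sroot G i x) (fvec G i)"
proof -
  have "na_brk (leaf (H x)) (leaf (F i)) + na_scl (sroot G i x) (leaf (F i)) \<in> chevalley_rels G"
    unfolding chevalley_rels_def by blast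
  from chevalley_relation[OF this] show ?thesis
    by (simp add: \<phi>_add \<phi>_scl \<phi>_brk \<phi>_H \<phi>_F add_eq_0_iff)
qed

lemma brk_evec_fvec: "brk G (evec G i) (fvec G i) = emb G (coroot G i)"
proof -
  have "na_brk (leaf (E i)) (leaf (F i)) - leaf (H (coroot G i)) \<in> chevalley_rels G"
    unfolding chevalley_rels_def by blast
  from chevalley_relation[OF this] show ?thesis
    by (simp add: \<phi>_diff \<phi>_brk \<phi>_H \<phi>_E \<phi>_F)
qed

lemma \<phi>_Node: "\<phi> (na_mono (Node u v)) = brk G (\<phi> (na_mono u)) (\<phi> (na_mono v))"
  unfolding \<phi>_brk[symmetric] by (simp add: na_brk_def)

lemma \<phi>_monomial_grade: "\<phi> (na_mono u) \<in> grade G (mono_par (par G) u)"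
proof (induction u)
  case (Leaf x)
  show ?case using emb_even by (cases x) (auto simp: \<phi>_E \<phi>_F \<phi>_H evec_grade fvec_grade)
next
  case (Node u v)
  have "brk G x y \<in> grade G (p + q)" if "x \<in> grade G p" "y \<in> grade G q" for x y p q
    using lie that unfolding lie_superalgebra_def by blast
  then show ?case unfolding \<phi>_Node mono_par.simps using Node by blast
qed

definition degree_weight :: "('i \<Rightarrow> int) \<Rightarrow> 'h \<Rightarrow> 'k" where
  "degree_weight n h = (\<Sum>j\<in>UNIV. of_int (n j) * sroot G j h)"

lemma \<phi>_monomial_weight:
  "brk G (emb G h) (\<phi> (na_mono u)) = scl G (degree_weight (monomial_degree u) h) (\<phi> (na_mono u))"
proof (induction u)
  case (Leaf x)
  show ?case
  proof (cases x)
    case (E i)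
    have "degree_weight (monomial_degree (Leaf x)) h = (\<Sum>j\<in>UNIV. if j = i then sroot G j h else 0)"
      unfolding E degree_weight_def by (intro sum.cong) auto
    then show ?thesis by (simp add: E \<phi>_E brk_emb_evec)
  next
    case (F i)
    have "degree_weight (monomial_degree (Leaf x)) h = (\<Sum>j\<in>UNIV. if j = i then - sroot G j h else 0)"
      unfolding F degree_weight_def by (intro sum.cong) auto
    then show ?thesis by (simp add: F \<phi>_F brk_emb_fvec)
  next
    case (H y)
    then show ?thesis by (simp add: \<phi>_H brk_emb_emb degree_weight_def)
  qed
next
  case (Node u v)
  let ?x = "\<phi> (na_mono u)" and ?y = "\<phi> (na_mono v)"
  have emb0: "emb G h \<in> grade G 0" using emb_even by blast
  have jac: "brk G a (brk G b z) = brk G (brk G a b) z + scl G (koszul p q) (brk G b (brk G a z))"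
    if "a \<in> grade G p" "b \<in> grade G q" for a b z p q
    using lie that unfolding lie_superalgebra_def by blast
  have "koszul 0 q = (1 :: 'k)" for q
    by (simp add: koszul_def)
  then have "brk G (emb G h) (brk G ?x ?y) = brk G (brk G (emb G h) ?x) ?y + brk G ?x (brk G (emb G h) ?y)"
    using jac[OF emb0 \<phi>_monomial_grade[of u], of ?y] by simp
  also have "\<dots> = scl G (degree_weight (monomial_degree u) h + degree_weight (monomial_degree v) h) (brk G ?x ?y)"
    by (simp add: Node brk_scl_left brk_scl_right g.scale_left_distrib)
  also have "degree_weight (monomial_degree u) h + degree_weight (monomial_degree v) h
      = degree_weight (monomial_degree (Node u v)) h"
    by (simp add: degree_weight_def sum.distrib[symmetric] distrib_right)
  finally show ?case unfolding \<phi>_Node .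
qed

lemma sroots_independent:
  assumes "\<And>h. (\<Sum>j\<in>UNIV. c j * sroot G j h) = 0"
  shows "c j = 0"
  using realization assms unfolding minimal_realization_def by blast

lemma degree_weight_inj:
  assumes "degree_weight m = degree_weight n"
  shows "m = n"
proof
  fix j
  have "(\<Sum>j\<in>UNIV. of_int (m j - n j) * sroot G j h) = 0" for h
    using fun_cong[OF assms, of h] by (simp add: degree_weight_def left_diff_distrib sum_subtractf)
  then have "of_int (m j - n j) = (0 :: 'k)" by (rule sroots_independent)
  then show "m j = n j" by simp
qed

text \<open>
Monomials in the Chevalley generators span and are weight vectors, so that a root vector is a
combination of the monomials of its own weight.
\<close>

lemma root_space_monomials:
  assumes "x \<in> root_space G \<delta>"
  obtains T c where "\<And>u. u \<in> T \<Longrightarrow> degree_weight (monomial_degree u) = \<delta>"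
    "x = (\<Sum>u\<in>T. scl G (c u) (\<phi> (na_mono u)))"
proof -
  obtain a where a: "x = \<phi> a" using \<phi>_surj by blast
  define T where "T = Poly_Mapping.keys a"
  define v where "v u = scl G (Poly_Mapping.lookup a u) (\<phi> (na_mono u))" for u
  have v: "v u = \<phi> (Poly_Mapping.single u (Poly_Mapping.lookup a u))" for u
    unfolding v_def \<phi>_scl[symmetric] by (simp add: na_scl_def)
  have "\<phi> (sum g U) = (\<Sum>u\<in>U. \<phi> (g u))" for g U
    by (induction U rule: infinite_finite_induct) (simp_all add: \<phi>_0 \<phi>_add)
  then have x: "x = (\<Sum>u\<in>T. v u)"
    unfolding v T_def a by (metis poly_mapping_eq_sum_single)
  have "(\<Sum>u | u \<in> T \<and> degree_weight (monomial_degree u) \<noteq> \<delta>. v u) \<in> {0}"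
  proof (rule g.other_weights_vanish[where f = "\<lambda>h. brk G (emb G h)"])
    show "g.subspace {0}" by (rule g.subspace_single_0)
    show "brk G (emb G h) (v u) - scl G (degree_weight (monomial_degree u) h) (v u) \<in> {0}" for u h
      by (simp add: v_def brk_scl_right \<phi>_monomial_weight g.scale_left_commute)
    show "brk G (emb G h) (sum v T) - scl G (\<delta> h) (sum v T) \<in> {0}" for h
      using assms unfolding x[symmetric] by (simp add: root_space_def)
  qed (simp_all add: brk_add_right brk_scl_right brk_0_right T_def)
  moreover have "x = (\<Sum>u | u \<in> T \<and> degree_weight (monomial_degree u) = \<delta>. v u)
      + (\<Sum>u | u \<in> T \<and> degree_weight (monomial_degree u) \<noteq> \<delta>. v u)"
    unfolding x by (subst sum.union_disjoint[symmetric]) (auto simp: T_def intro!: sum.cong)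
  ultimately have "x = (\<Sum>u | u \<in> T \<and> degree_weight (monomial_degree u) = \<delta>. v u)" by simp
  then show ?thesis
    by (intro that[of "{u \<in> T. degree_weight (monomial_degree u) = \<delta>}" "Poly_Mapping.lookup a"])
      (simp_all add: v_def)
qed

text \<open>
All monomials of weight \<open>\<delta>\<close> have the same degree, as the simple roots are linearly independent and
the field has characteristic zero. Hence they have the same parity.
\<close>

lemma root_space_homogeneous: "\<exists>p. root_space G \<delta> \<subseteq> grade G p"
proof -
  define p where "p = mono_par (par G) (SOME u :: ('i, 'h) chevalley monomial. degree_weight (monomial_degree u) = \<delta>)"
  have p: "mono_par (par G) u = p" if "degree_weight (monomial_degree u) = \<delta>" for u :: "('i, 'h) chevalley monomial"
  proof -
    have "degree_weight (monomial_degree (SOME u :: ('i, 'h) chevalley monomial. degree_weight (monomial_degree u) = \<delta>)) = \<delta>"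
      using someI[of "\<lambda>u. degree_weight (monomial_degree u) = \<delta>", OF that] .
    then have "monomial_degree u = monomial_degree (SOME u :: ('i, 'h) chevalley monomial. degree_weight (monomial_degree u) = \<delta>)"
      using that by (intro degree_weight_inj) simp
    then show ?thesis by (simp add: p_def mono_par_eq_degree)
  qed
  have "x \<in> grade G p" if x: "x \<in> root_space G \<delta>" for x
  proof -
    obtain T c where T: "\<And>u. u \<in> T \<Longrightarrow> degree_weight (monomial_degree u) = \<delta>"
      "x = (\<Sum>u\<in>T. scl G (c u) (\<phi> (na_mono u)))"
      using x by (rule root_space_monomials) blast
    have "g.subspace (grade G p)" using lie by (simp add: lie_superalgebra_def)
    moreover have "\<phi> (na_mono u) \<in> grade G p" if "u \<in> T" for u
      using \<phi>_monomial_grade[of u] p[OF T(1)[OF that]] by simp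
    ultimately show ?thesis unfolding T(2) by (intro g.subspace_sum g.subspace_scale)
  qed
  then show ?thesis by blast
qed

lemma root_coord_sroot: "root_coord G (sroot G i) = (\<lambda>j. if j = i then 1 else 0)"
proof -
  let ?d = "\<lambda>j. if j = i then 1 else 0 :: 'k"
  have d: "(\<Sum>j\<in>UNIV. ?d j * sroot G j h) = sroot G i h" for h
  proof -
    have "(\<Sum>j\<in>UNIV. ?d j * sroot G j h) = (\<Sum>j\<in>UNIV. if j = i then sroot G j h else 0)"
      by (intro sum.cong) auto
    then show ?thesis by simp
  qed
  have "sroot G i = (\<lambda>h. \<Sum>j\<in>UNIV. root_coord G (sroot G i) j * sroot G j h)"
    unfolding root_coord_def by (rule someI[of _ ?d]) (simp only: d)
  then have *: "sroot G i h = (\<Sum>j\<in>UNIV. root_coord G (sroot G i) j * sroot G j h)" for h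
    by (rule fun_cong)
  have "root_coord G (sroot G i) j - ?d j = 0" for j
  proof (rule sroots_independent[of "\<lambda>j. root_coord G (sroot G i) j - ?d j"])
    show "(\<Sum>j\<in>UNIV. (root_coord G (sroot G i) j - ?d j) * sroot G j h) = 0" for h
      unfolding left_diff_distrib sum_subtractf d *[symmetric] by simp
  qed
  then show ?thesis by (intro ext) simp
qed

lemma nonisotropic_sroot:
  assumes "nonisotropic G (sroot G i)"
  shows "cmat G i i \<noteq> 0"
proof
  assume "cmat G i i = 0"
  then have "(if j = i then 1 else 0) * (if k = i then 1 else 0) * (symm G j * cmat G j k) = 0" for j k
    by simp
  then have "root_form G (sroot G i) (sroot G i) = 0"
    unfolding root_form_def root_coord_sroot by (simp only: sum.neutral_const)
  then show False using assms by (simp add: nonisotropic_def)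
qed

text \<open>
The vector \<open>evec G i\<close> is a root vector unless it vanishes. In that case its bracket with
\<open>fvec G i\<close>, the coroot, acts as zero on \<open>e\<close>; but it acts by the scalar \<open>- cmat G i i\<close>, which is
nonzero for a nonisotropic root.
\<close>

lemma sroot_positive_root:
  assumes "nonisotropic G (sroot G i)" and e: "e \<in> root_space G (\<lambda>h. - sroot G i h)" "e \<noteq> 0"
  shows "positive_root G (sroot G i)"
proof -
  have coroot: "sroot G i (coroot G i) \<noteq> 0"
    using nonisotropic_sroot[OF assms(1)] realization by (simp add: minimal_realization_def)
  have "evec G i \<noteq> 0"
  proof
    assume "evec G i = 0"
    then have "emb G (coroot G i) = 0" using brk_evec_fvec[of i] by (simp add: brk_0_left)
    then have "scl G (- sroot G i (coroot G i)) e = 0"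
      using e(1) unfolding root_space_def by (metis (mono_tags, lifting) brk_0_left mem_Collect_eq)
    then show False using coroot e(2) by simp
  qed
  moreover have "evec G i \<in> root_space G (sroot G i)" by (simp add: root_space_def brk_emb_evec)
  ultimately have "is_root G (sroot G i)" unfolding is_root_def using coroot by blast
  moreover have "sroot G i = (\<lambda>h. \<Sum>j\<in>UNIV. of_nat (if j = i then 1 else 0) * sroot G j h)"
  proof
    fix h
    have "(\<Sum>j\<in>UNIV. of_nat (if j = i then 1 else 0) * sroot G j h) = (\<Sum>j\<in>UNIV. if j = i then sroot G j h else 0)"
      by (intro sum.cong) auto
    then show "sroot G i h = (\<Sum>j\<in>UNIV. of_nat (if j = i then 1 else 0) * sroot G j h)" by simp
  qed
  ultimately show ?thesis unfolding positive_root_def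
    by (intro conjI exI[of _ "\<lambda>j. if j = i then 1 else 0"])
qed

text \<open>
A maximal independent set of negative root vectors, which is finite as the algebra is finite
dimensional.
\<close>

lemma nminus_homogeneous_generators:
  assumes "finite_dimensional G"
  obtains B pr wt where "homogeneous_generators G B pr wt"
proof -
  define R where "R = (\<Union>\<delta>\<in>Collect (positive_root G). root_space G (\<lambda>h. - \<delta> h))"
  obtain C where C: "finite C" "g.span C = UNIV"
    using assms unfolding finite_dimensional_def by blast
  obtain B where B: "B \<subseteq> R" "g.independent B" "R \<subseteq> g.span B"
    by (rule g.maximal_independent_subset)
  have "finite B" using g.independent_span_bound[OF C(1) B(2)] C(2) by simp
  moreover have "nminus G = g.span B"
    unfolding nminus_def R_def[symmetric]
    by (rule antisym[OF g.span_minimal[OF B(3) g.subspace_span] g.span_mono[OF B(1)]])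
  moreover have "\<forall>b\<in>B. \<exists>\<delta>. b \<in> root_space G (\<lambda>h. - \<delta> h)" using B(1) unfolding R_def by blast
  then obtain wt where wt: "\<And>b. b \<in> B \<Longrightarrow> b \<in> root_space G (\<lambda>h. - wt b h)" by metis
  moreover have "\<forall>b\<in>B. \<exists>p. b \<in> grade G p" using wt root_space_homogeneous by blast
  then obtain pr where "\<And>b. b \<in> B \<Longrightarrow> b \<in> grade G (pr b)" by metis
  ultimately have "homogeneous_generators G B pr wt"
    using lie emb_even by unfold_locales (simp_all add: root_space_def)
  then show ?thesis by (rule that)
qed

end

lemma contragredient_presentation:
  assumes "contragredient G"
  obtains \<phi> where "chevalley_presentation G \<phi>"
proof -
  have "\<exists>\<phi>. Vector_Spaces.linear na_scl (scl G) \<phi> \<and> surj \<phi> \<and>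
        (\<forall>a b. \<phi> (na_brk a b) = brk G (\<phi> a) (\<phi> b)) \<and>
        (\<forall>i. \<phi> (leaf (E i)) = evec G i) \<and> (\<forall>i. \<phi> (leaf (F i)) = fvec G i) \<and>
        (\<forall>x. \<phi> (leaf (H x)) = emb G x) \<and>
        {a. \<phi> a = 0} = maximal_ideal G" (is "\<exists>\<phi>. ?P \<phi>")
    using assms unfolding contragredient_def by (elim conjE)
  then obtain \<phi> where \<phi>: "?P \<phi>" ..
  have "lie_superalgebra G \<and> minimal_realization G \<and>
     (\<forall>i. evec G i \<in> grade G (par G i) \<and> fvec G i \<in> grade G (par G i)) \<and>
     range (emb G) \<subseteq> grade G 0"
    using assms unfolding contragredient_def by (elim conjE, intro conjI)
  with \<phi> have "chevalley_presentation G \<phi>"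
    unfolding chevalley_presentation_def by simp
  then show ?thesis by (rule that)
qed

section \<open>Finite generation\<close>

theorem lemma5p6:
  fixes G :: "('k::{alg_closed_field, field_char_0}, 'g::ab_group_add, 'h::ab_group_add, 'i::finite) superdata"
    and i :: 'i and \<alpha> \<beta> \<gamma> :: "'h \<Rightarrow> 'k" and q :: nat and e :: 'g
  assumes "kac_moody_superalgebra G"
    and "finite_dimensional G"
    and "positive_root G \<beta>" and "real_root G \<beta>" and "nonisotropic G \<beta>"
    and "\<alpha> = sroot G i" and "nonisotropic G \<alpha>"
    and "\<gamma> = root_reflection G \<alpha> \<beta>"
    and "\<gamma> = (\<lambda>h. \<beta> h + of_nat q * \<alpha> h)" and "q > 0"
    and "e \<in> root_space G (\<lambda>h. - \<alpha> h)" and "e \<noteq> 0"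
  shows "finitely_generated_algebra (sym_loc_const G e) (sapovalov_algebra G \<alpha> e \<gamma>)
       \<and> finitely_generated_algebra (sym_loc_const G e) (sapovalov_algebra G \<alpha> e \<beta>)"
proof -
  have "contragredient G" using assms(1) by (simp add: kac_moody_superalgebra_def)
  then obtain \<phi> where "chevalley_presentation G \<phi>" by (rule contragredient_presentation)
  then interpret P: chevalley_presentation G \<phi> .
  obtain B pr wt where "homogeneous_generators G B pr wt"
    using assms(2) by (rule P.nminus_homogeneous_generators)
  then interpret Q: homogeneous_generators G B pr wt .
  obtain p where p: "root_space G (\<lambda>h. - \<alpha> h) \<subseteq> grade G p"
    using P.root_space_homogeneous by blast
  have "positive_root G \<alpha>"
    using P.sroot_positive_root assms(6,7,11,12) by blast
  then have "e \<in> nminus G"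
    unfolding nminus_def using assms(11) by (intro P.g.span_base) blast
  then have "localized_generators G B pr wt \<alpha> e p"
    using p assms(11) by unfold_locales blast+
  then show ?thesis
    using localized_generators.finitely_generated_sapovalov by blast
qed

end
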